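(* Consider a semi-adaptive adversary for online set cover which fixes beforehand a super-instance $(X,\mathcal{S})$ and a cost function $c:\mathcal{S}\to\mathbb{R}_{\ge0}$, and which, along with the adaptively chosen arriving elements (forming $X'\subseteq X$), provides a monotonically increasing fractional solution $x\in[0,1]^{\mathcal{S}}$ that is feasible for all elements arrived so far. There is an online rounding algorithm against such an adversary which produces an integral set cover of $(X',\mathcal{S})$ of expected cost at most $O(\log|X|)\cdot\mathbb{E}[c^Tx]$, where $x$ is the final fractional solution. Consequently, there is an $O(\log|X|\cdot\log|\mathcal{S}|)$-competitive online algorithm for set cover against a semi-adaptive adversary.
   Context: Online set cover: a set system $(X,\mathcal{S})$ with costs $c:\mathcal{S}\to\mathbb{R}_{\ge0}$; at each step an element $e\in X$ arrives together with all sets containing it and their costs; if $e$ is not covered by previously chosen sets, the algorithm must (irrevocably) choose some set containing $e$, paying its cost. A fractional solution $x$ is feasible at a time if $\sum_{S\ni e}x_S\ge1$ for every arrived element $e$; monotone means each $x_S$ never decreases over time. A semi-adaptive adversary must commit beforehand to the super-instance (not revealed to the algorithm) and then chooses adaptively, based on the algorithm's random actions so far, which elements of $X$ arrive (and, here, the fractional values). Competitive ratio against it: $\mathbb{E}[\mathsf{ALG}]\le\gamma\,\mathbb{E}[\mathsf{OPT}]$, where $\mathsf{OPT}$ is the offline optimum of the presented instance. *)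

theory Defs
  imports "HOL-Probability.Probability"
begin

section \<open>Set systems\<close>

text \<open>
  The sets of the system are represented by names of type \<open>'s\<close>; the contents of the set named
  \<open>S\<close> is \<open>members I S\<close>.  An online algorithm gets to see names only, so learning that \<open>S\<close> contains
  the arriving element does not tell it which other elements \<open>S\<close> contains.
\<close>

record ('e, 's) set_system =
  ground :: "'e set"
  family :: "'s set"
  members :: "'s \<Rightarrow> 'e set"
  price :: "'s \<Rightarrow> real"

definition super_instance :: "('e, 's) set_system \<Rightarrow> bool" where
  "super_instance I \<longleftrightarrow>
     finite (ground I) \<and> finite (family I) \<and>
     (\<forall>S\<in>family I. members I S \<subseteq> ground I) \<and>
     (\<forall>S\<in>family I. 0 \<le> price I S)"

definition containing :: "('e, 's) set_system \<Rightarrow> 'e \<Rightarrow> 's set" where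
  "containing I e = {S \<in> family I. e \<in> members I S}"

definition covers :: "('e, 's) set_system \<Rightarrow> 's set \<Rightarrow> 'e set \<Rightarrow> bool" where
  "covers I \<C> E \<longleftrightarrow> \<C> \<subseteq> family I \<and> E \<subseteq> (\<Union>S\<in>\<C>. members I S)"

definition total_price :: "('e, 's) set_system \<Rightarrow> 's set \<Rightarrow> real" where
  "total_price I \<C> = (\<Sum>S\<in>\<C>. price I S)"

definition opt :: "('e, 's) set_system \<Rightarrow> 'e set \<Rightarrow> real" where
  "opt I E = Min (total_price I ` {\<C>. covers I \<C> E})"


section \<open>The online game\<close>

text \<open>
  An algorithm maps its own past (observations, private random numbers, sets bought) and the
  current observation to a distribution on a private random number, which the adversary never
  sees, and the collection of sets to buy now.  An adversary maps the public past (its own moves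
  and the sets bought in response) to a distribution on its next move, where \<open>None\<close> ends the game.
\<close>

type_synonym ('o, 's) algorithm = "('o \<times> nat \<times> 's set) list \<Rightarrow> 'o \<Rightarrow> (nat \<times> 's set) pmf"
type_synonym ('m, 's) adversary = "('m \<times> 's set) list \<Rightarrow> 'm option pmf"
type_synonym ('m, 's) transcript = "('m \<times> nat \<times> 's set) list"

definition moves :: "('m, 's) transcript \<Rightarrow> 'm list" where
  "moves h = map fst h"

definition purchases :: "('m, 's) transcript \<Rightarrow> 's set list" where
  "purchases h = map (\<lambda>(m, r, P). P) h"

definition bought :: "('m, 's) transcript \<Rightarrow> 's set" where
  "bought h = \<Union> (set (purchases h))"

definition adversary_view :: "('m, 's) transcript \<Rightarrow> ('m \<times> 's set) list" where
  "adversary_view h = map (\<lambda>(m, r, P). (m, P)) h"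

text \<open>
  The function \<open>obs\<close> yields what the algorithm is shown after a nonempty sequence of moves.
\<close>

definition algorithm_view ::
  "('m list \<Rightarrow> 'o) \<Rightarrow> ('m, 's) transcript \<Rightarrow> ('o \<times> nat \<times> 's set) list" where
  "algorithm_view obs h =
     map (\<lambda>j. (obs (take (Suc j) (moves h)), snd (h ! j))) [0..<length h]"

primrec continue_play ::
  "('m list \<Rightarrow> 'o) \<Rightarrow> ('o, 's) algorithm \<Rightarrow> ('m, 's) adversary \<Rightarrow>
   nat \<Rightarrow> ('m, 's) transcript \<Rightarrow> ('m, 's) transcript pmf" where
  "continue_play obs A D 0 h = return_pmf h"
| "continue_play obs A D (Suc t) h =
     bind_pmf (D (adversary_view h)) (\<lambda>mo.
       case mo of
         None \<Rightarrow> return_pmf h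
       | Some m \<Rightarrow>
           bind_pmf (A (algorithm_view obs h) (obs (moves h @ [m]))) (\<lambda>(r, P).
             continue_play obs A D t (h @ [(m, r, P)])))"

text \<open>The game from the beginning, with at most \<open>T\<close> arrivals.\<close>

definition play ::
  "('m list \<Rightarrow> 'o) \<Rightarrow> ('o, 's) algorithm \<Rightarrow> ('m, 's) adversary \<Rightarrow> nat \<Rightarrow>
   ('m, 's) transcript pmf" where
  "play obs A D T = continue_play obs A D T []"

definition obeys :: "('m, 's) adversary \<Rightarrow> ('m list \<Rightarrow> bool) \<Rightarrow> bool" where
  "obeys D legal \<longleftrightarrow>
     (\<forall>v m. legal (map fst v) \<longrightarrow> Some m \<in> set_pmf (D v) \<longrightarrow> legal (map fst v @ [m]))"

definition revealed :: "('e, 's) set_system \<Rightarrow> 'e set \<Rightarrow> 's set" where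
  "revealed I E = (\<Union>e\<in>E. containing I e)"

text \<open>
  Right after each arrival, all elements that have arrived are covered by the sets bought so far,
  and only sets that have been revealed by then are bought.
\<close>

definition covers_online :: "('e, 's) set_system \<Rightarrow> 'e list \<Rightarrow> 's set list \<Rightarrow> bool" where
  "covers_online I es Ps \<longleftrightarrow>
     (\<forall>k\<le>length es.
        let E = set (take k es); \<C> = \<Union> (set (take k Ps))
        in \<C> \<subseteq> revealed I E \<and> covers I \<C> E)"


section \<open>Moves that present elements only\<close>

definition mask :: "'s set \<Rightarrow> ('s \<Rightarrow> real) \<Rightarrow> 's \<Rightarrow> real" where
  "mask N f = (\<lambda>S. if S \<in> N then f S else 0)"

type_synonym ('e, 's) arrival = "'e \<times> 's set \<times> ('s \<Rightarrow> real)"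

definition arrival :: "('e, 's) set_system \<Rightarrow> 'e \<Rightarrow> ('e, 's) arrival" where
  "arrival I e = (e, containing I e, mask (containing I e) (price I))"

definition element_obs :: "('e, 's) set_system \<Rightarrow> 'e list \<Rightarrow> ('e, 's) arrival" where
  "element_obs I es = arrival I (last es)"

definition element_legal :: "('e, 's) set_system \<Rightarrow> 'e list \<Rightarrow> bool" where
  "element_legal I es \<longleftrightarrow> (\<forall>e\<in>set es. e \<in> ground I \<and> containing I e \<noteq> {})"


section \<open>Moves that also present a fractional solution\<close>

text \<open>
  A move \<open>(e, x)\<close> presents the element \<open>e\<close> and the new fractional solution \<open>x\<close>.  The algorithm is
  shown the values of \<open>x\<close> on the sets revealed so far; it does not know that other sets exist.
\<close>

type_synonym ('e, 's) frac_move = "'e \<times> ('s \<Rightarrow> real)"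
type_synonym ('e, 's) frac_arrival = "('e, 's) arrival \<times> ('s \<Rightarrow> real)"

definition frac_obs ::
  "('e, 's) set_system \<Rightarrow> ('e, 's) frac_move list \<Rightarrow> ('e, 's) frac_arrival" where
  "frac_obs I ms =
     (arrival I (fst (last ms)), mask (revealed I (fst ` set ms)) (snd (last ms)))"

definition frac_feasible :: "('e, 's) set_system \<Rightarrow> ('s \<Rightarrow> real) \<Rightarrow> 'e set \<Rightarrow> bool" where
  "frac_feasible I x E \<longleftrightarrow> (\<forall>e\<in>E. 1 \<le> (\<Sum>S\<in>containing I e. x S))"

definition frac_legal :: "('e, 's) set_system \<Rightarrow> ('e, 's) frac_move list \<Rightarrow> bool" where
  "frac_legal I ms \<longleftrightarrow>
     (\<forall>k<length ms.
        fst (ms ! k) \<in> ground I \<and>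
        (\<forall>S\<in>family I. snd (ms ! k) S \<in> {0..1}) \<and>
        (\<forall>j\<le>k. \<forall>S\<in>family I. snd (ms ! j) S \<le> snd (ms ! k) S) \<and>
        frac_feasible I (snd (ms ! k)) (fst ` set (take (Suc k) ms)))"

text \<open>The cost of the final fractional solution, which is zero if nothing has arrived.\<close>

definition frac_cost :: "('e, 's) set_system \<Rightarrow> ('e, 's) frac_move list \<Rightarrow> real" where
  "frac_cost I ms =
     (if ms = [] then 0 else \<Sum>S\<in>family I. price I S * snd (last ms) S)"

end

(*
  Rounding.  When L x_S grows by h, the set S is bought with probability 1 - e^(-h), independently of
  the others.  An arriving element that is still uncovered buys its cheapest set and raises
  L by 1/2.  The algorithm knows neither |X| nor the final fractional cost, so L starts at 0 again
  whenever the fractional cost exceeds a cap U, and U is then set to twice that cost.  While U is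
  fixed, a supermartingale is
    Psi = e^M + (sum of e^(L y_e) over the elements e that have not arrived and are not covered),
  where y_e is the fractional coverage of e and M is the value L takes at the next arrival: an
  uncovered arriving element has y_e >= 1, so it leaves the sum and thereby pays for the growth of
  e^M.  Hence the expectation of M is at most ln (|X| + 1) in each phase, even though the adversary
  is adaptive.  Both kinds of purchases are paid for by U * M, and the caps sum up geometrically.

  Fractional algorithm.  With N the sets containing an uncovered arriving element, raise the dual
  variable t of the element and let x_S grow as (x_S + 1/|N|) e^(t / c_S) - 1/|N| for S in N until
  the element is covered exactly.  The cost is at most 2 t, and x_S + 1/m, with m the number of all
  sets, grows by a factor of at least e^(t / c_S), so the dual variables of the elements
  of S sum up to at most c_S ln (m + 1).
*)

theory Submission
  imports Defs
begin

section \<open>Expectations over plays\<close>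

lemma moves_Nil [simp]: "moves [] = []"
  and moves_snoc [simp]: "moves (h @ [(m, r, P)]) = moves h @ [m]"
  and purchases_Nil [simp]: "purchases [] = []"
  and purchases_snoc [simp]: "purchases (h @ [(m, r, P)]) = purchases h @ [P]"
  and bought_Nil [simp]: "bought [] = {}"
  and bought_snoc [simp]: "bought (h @ [(m, r, P)]) = bought h \<union> P"
  by (auto simp: moves_def purchases_def bought_def)

lemma length_moves [simp]: "length (moves h) = length h"
  and length_purchases [simp]: "length (purchases h) = length h"
  and length_algorithm_view [simp]: "length (algorithm_view f h) = length h"
  by (simp_all add: moves_def purchases_def algorithm_view_def)

lemma algorithm_view_Nil [simp]: "algorithm_view f [] = []"
  by (simp add: algorithm_view_def)

lemma algorithm_view_snoc [simp]:
  "algorithm_view f (h @ [(m, r, P)]) = algorithm_view f h @ [(f (moves h @ [m]), r, P)]"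
  by (auto simp: algorithm_view_def nth_append intro!: nth_equalityI)

lemma map_fst_adversary_view [simp]: "map fst (adversary_view h) = moves h"
  by (auto simp: adversary_view_def moves_def)

lemma continue_play_invariant:
  assumes step: "\<And>h m r P. Inv h \<Longrightarrow> Some m \<in> set_pmf (D (adversary_view h)) \<Longrightarrow>
      (r, P) \<in> set_pmf (A (algorithm_view obs h) (obs (moves h @ [m]))) \<Longrightarrow> Inv (h @ [(m, r, P)])"
    and "Inv h" and "h' \<in> set_pmf (continue_play obs A D t h)"
  shows "Inv h'"
  using assms(2,3)
proof (induction t arbitrary: h)
  case 0
  then show ?case by simp
next
  case (Suc t)
  from Suc.prems(2) obtain mo where mo: "mo \<in> set_pmf (D (adversary_view h))"
    and h': "h' \<in> set_pmf (case mo of None \<Rightarrow> return_pmf h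
       | Some m \<Rightarrow> bind_pmf (A (algorithm_view obs h) (obs (moves h @ [m]))) (\<lambda>(r, P).
             continue_play obs A D t (h @ [(m, r, P)])))"
    by auto
  show ?case
  proof (cases mo)
    case None
    then show ?thesis using h' Suc.prems by simp
  next
    case (Some m)
    with h' obtain r P where "(r, P) \<in> set_pmf (A (algorithm_view obs h) (obs (moves h @ [m])))"
      "h' \<in> set_pmf (continue_play obs A D t (h @ [(m, r, P)]))" by auto
    then show ?thesis using Suc.IH step Suc.prems(1) mo Some by blast
  qed
qed

text \<open>\<open>F\<close> is a supermartingale for each single move that the adversary may make,
  so its adaptivity and its randomness do no harm. Its distributions may have infinite support, on
  which \<open>F\<close> need not be integrable; hence the induction runs on nonnegative integrals
  shifted by \<open>K\<close>.\<close>

lemma continue_play_expectation_le: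
  fixes F g :: "('m, 's) transcript \<Rightarrow> real"
  assumes step: "\<And>h m r P. Inv h \<Longrightarrow> Some m \<in> set_pmf (D (adversary_view h)) \<Longrightarrow>
      (r, P) \<in> set_pmf (A (algorithm_view obs h) (obs (moves h @ [m]))) \<Longrightarrow> Inv (h @ [(m, r, P)])"
    and fin: "\<And>h m. Inv h \<Longrightarrow> Some m \<in> set_pmf (D (adversary_view h)) \<Longrightarrow>
      finite (set_pmf (A (algorithm_view obs h) (obs (moves h @ [m]))))"
    and super: "\<And>h m. Inv h \<Longrightarrow> Some m \<in> set_pmf (D (adversary_view h)) \<Longrightarrow>
      measure_pmf.expectation (A (algorithm_view obs h) (obs (moves h @ [m])))
        (\<lambda>(r, P). F (h @ [(m, r, P)])) \<le> F h"
    and bound: "\<And>h. Inv h \<Longrightarrow> \<bar>g h\<bar> \<le> K"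
    and le: "\<And>h. Inv h \<Longrightarrow> g h \<le> F h"
    and "Inv h"
  shows "measure_pmf.expectation (continue_play obs A D t h) g \<le> F h"
proof -
  \<comment> \<open>As \<open>g\<close> is at least \<open>- K\<close> and at most \<open>F\<close>,
    both become nonnegative after the shift, so that \<open>ennreal\<close> loses nothing.\<close>
  have lower: "0 \<le> F h + K" if "Inv h" for h
    using bound[OF that] le[OF that] by linarith
  have "(\<integral>\<^sup>+ h'. ennreal (g h' + K) \<partial>continue_play obs A D t h) \<le> ennreal (F h + K)"
    using \<open>Inv h\<close>
  proof (induction t arbitrary: h)
    case 0
    then show ?case using le by (simp add: nn_integral_return ennreal_leI)
  next
    case (Suc t)
    have inner: "(\<integral>\<^sup>+ h'. ennreal (g h' + K) \<partial>(case mo of None \<Rightarrow> return_pmf h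
       | Some m \<Rightarrow> bind_pmf (A (algorithm_view obs h) (obs (moves h @ [m]))) (\<lambda>(r, P).
             continue_play obs A D t (h @ [(m, r, P)])))) \<le> ennreal (F h + K)"
      if mo: "mo \<in> set_pmf (D (adversary_view h))" for mo
    proof (cases mo)
      case None
      then show ?thesis using le Suc.prems by (simp add: nn_integral_return ennreal_leI)
    next
      case (Some m)
      let ?p = "A (algorithm_view obs h) (obs (moves h @ [m]))"
      let ?F = "\<lambda>(r, P). F (h @ [(m, r, P)])"
      have inv: "Inv (h @ [(m, r, P)])" if "(r, P) \<in> set_pmf ?p" for r P
        using step Suc.prems mo Some that by blast
      have fin': "finite (set_pmf ?p)"
        using fin Suc.prems mo Some by blast
      have "(\<integral>\<^sup>+ rP. \<integral>\<^sup>+ h'. ennreal (g h' + K) \<partial>(case rP of (r, P) \<Rightarrow>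
               continue_play obs A D t (h @ [(m, r, P)])) \<partial>?p)
            \<le> (\<integral>\<^sup>+ rP. ennreal (?F rP + K) \<partial>?p)"
        by (intro nn_integral_mono_AE) (auto simp: AE_measure_pmf_iff intro!: Suc.IH inv)
      \<comment> \<open>A response has finite support, so the integral turns back into an ordinary
        expectation, to which \<open>super\<close> applies.\<close>
      also have "\<dots> = ennreal (measure_pmf.expectation ?p (\<lambda>rP. ?F rP + K))"
        by (intro nn_integral_eq_integral integrable_measure_pmf_finite fin')
          (auto simp: AE_measure_pmf_iff intro!: lower inv)
      also have "measure_pmf.expectation ?p (\<lambda>rP. ?F rP + K) = measure_pmf.expectation ?p ?F + K"
        by (subst Bochner_Integration.integral_add)
          (auto intro!: integrable_measure_pmf_finite fin')
      also have "ennreal \<dots> \<le> ennreal (F h + K)"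
        using super[OF Suc.prems] mo Some by (intro ennreal_leI) auto
      finally show ?thesis using Some by simp
    qed
    have "(\<integral>\<^sup>+ h'. ennreal (g h' + K) \<partial>continue_play obs A D (Suc t) h)
        \<le> (\<integral>\<^sup>+ mo. ennreal (F h + K) \<partial>D (adversary_view h))"
      unfolding continue_play.simps nn_integral_bind_pmf
      by (intro nn_integral_mono_AE) (auto simp: AE_measure_pmf_iff intro!: inner)
    then show ?case by simp
  qed
  moreover have AE: "AE h' in continue_play obs A D t h. Inv h'"
    using continue_play_invariant[where Inv = Inv, OF step \<open>Inv h\<close>]
    by (auto simp: AE_measure_pmf_iff)
  have int: "integrable (continue_play obs A D t h) g"
    using AE by (intro measure_pmf.integrable_const_bound[of _ K]) (auto dest!: bound)
  have "(\<integral>\<^sup>+ h'. ennreal (g h' + K) \<partial>continue_play obs A D t h)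
      = ennreal (measure_pmf.expectation (continue_play obs A D t h) (\<lambda>h'. g h' + K))"
    using AE int by (intro nn_integral_eq_integral)
      (auto simp: int intro!: Bochner_Integration.integrable_add elim!: eventually_mono dest!: bound)
  moreover have "measure_pmf.expectation (continue_play obs A D t h) (\<lambda>h'. g h' + K)
      = measure_pmf.expectation (continue_play obs A D t h) g + K"
    using int by simp
  ultimately show ?thesis
    using lower[OF \<open>Inv h\<close>] by (simp add: ennreal_le_iff)
qed

section \<open>Rounding a fractional solution online\<close>

definition random_subset :: "'s set \<Rightarrow> ('s \<Rightarrow> real) \<Rightarrow> 's set pmf" where
  "random_subset N q =
     map_pmf (\<lambda>f. {S\<in>N. f S}) (Pi_pmf N False (\<lambda>S. bernoulli_pmf (q S)))"

lemma set_random_subset: "P \<in> set_pmf (random_subset N q) \<Longrightarrow> P \<subseteq> N"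
  by (auto simp: random_subset_def)

lemma finite_random_subset: "finite N \<Longrightarrow> finite (set_pmf (random_subset N q))"
  by (rule finite_subset[of _ "Pow N"]) (auto dest: set_random_subset)

lemma expectation_random_subset:
  assumes N: "finite N" and q: "\<And>S. S \<in> N \<Longrightarrow> 0 \<le> q S \<and> q S \<le> 1"
  shows "measure_pmf.expectation (random_subset N q) (\<lambda>P. \<Sum>S\<in>P. c S) = (\<Sum>S\<in>N. c S * q S)"
proof -
  let ?p = "Pi_pmf N False (\<lambda>S. bernoulli_pmf (q S))"
  have fin: "finite (set_pmf ?p)"
    using N by (subst set_Pi_pmf) (auto intro!: finite_PiE_dflt)
  have "measure_pmf.expectation (random_subset N q) (\<lambda>P. \<Sum>S\<in>P. c S)
      = measure_pmf.expectation ?p (\<lambda>f. \<Sum>S\<in>N. if f S then c S else 0)"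
    unfolding random_subset_def integral_map_pmf
    by (intro Bochner_Integration.integral_cong refl) (simp add: N sum.inter_filter)
  also have "\<dots> = (\<Sum>S\<in>N. measure_pmf.expectation ?p (\<lambda>f. if f S then c S else 0))"
    by (intro Bochner_Integration.integral_sum integrable_measure_pmf_finite fin)
  also have "\<dots> = (\<Sum>S\<in>N. measure_pmf.expectation (map_pmf (\<lambda>f. f S) ?p) (\<lambda>b. if b then c S else 0))"
    by simp
  also have "\<dots> = (\<Sum>S\<in>N. c S * q S)"
    using N q by (intro sum.cong refl) (simp add: Pi_pmf_component)
  finally show ?thesis .
qed

text \<open>By independence the probability of missing all of \<open>B\<close> is the product of the
  factors \<open>exp (- h S)\<close>; in this parametrization hazards simply add up.\<close>

lemma prob_random_subset_disjoint:
  assumes N: "finite N" and B: "B \<subseteq> N" and h: "\<And>S. S \<in> N \<Longrightarrow> 0 \<le> h S"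
  shows "measure_pmf.expectation (random_subset N (\<lambda>S. 1 - exp (- h S)))
           (\<lambda>P. if B \<inter> P = {} then 1 else 0) = exp (- (\<Sum>S\<in>B. h S) :: real)"
proof -
  let ?p = "Pi_pmf N False (\<lambda>S. bernoulli_pmf (1 - exp (- h S)))"
  have "measure_pmf.expectation (random_subset N (\<lambda>S. 1 - exp (- h S)))
           (\<lambda>P. if B \<inter> P = {} then 1 else 0 :: real)
      = measure_pmf.expectation ?p (\<lambda>f. \<Prod>S\<in>N. if S \<in> B \<and> f S then 0 else 1)"
    unfolding random_subset_def integral_map_pmf
    using N B by (intro Bochner_Integration.integral_cong refl) (auto intro!: prod.neutral)
  also have "\<dots> = (\<Prod>S\<in>N. measure_pmf.expectation (bernoulli_pmf (1 - exp (- h S)))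
      (\<lambda>b. if S \<in> B \<and> b then 0 else 1))"
    by (intro expectation_prod_Pi_pmf[OF N] integrable_measure_pmf_finite) auto
  also have "\<dots> = (\<Prod>S\<in>N. if S \<in> B then exp (- h S) else 1)"
    using h by (intro prod.cong refl) auto
  also have "\<dots> = (\<Prod>S\<in>B. exp (- h S))"
    using N B by (simp add: prod.inter_restrict[symmetric] inf.absorb2)
  finally show ?thesis
    using finite_subset[OF B N] by (simp add: exp_sum sum_negf[symmetric])
qed

section \<open>The rounding algorithm and its state\<close>

record 's rounding_state =
  known :: "'s set"
  costs :: "'s \<Rightarrow> real"
  sol :: "'s \<Rightarrow> real"
  cap :: real
  level :: real
  target :: real
  chosen :: "'s set"

definition init_state :: "'s rounding_state" where
  "init_state = \<lparr>known = {}, costs = (\<lambda>_. 0), sol = (\<lambda>_. 0), cap = 0, level = 0, target = 0,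
     chosen = {}\<rparr>"

definition value_of :: "'s rounding_state \<Rightarrow> real" where
  "value_of st = (\<Sum>S\<in>known st. costs st S * sol st S)"

definition learn :: "'s rounding_state \<Rightarrow> ('e, 's) frac_arrival \<Rightarrow> 's rounding_state" where
  "learn st ob = (case ob of ((e, N, c), x) \<Rightarrow>
     st\<lparr>known := known st \<union> N, costs := (\<lambda>S. if S \<in> N then c S else costs st S), sol := x\<rparr>)"

text \<open>\<open>cap\<close> starts at 0, so the first positive fractional cost opens a phase.
  Within a phase the level moves up to \<open>target\<close>, which a repair at the previous arrival
  may have raised.\<close>

definition observe :: "'s rounding_state \<Rightarrow> ('e, 's) frac_arrival \<Rightarrow> 's rounding_state" where
  "observe st ob = (let st' = learn st ob in
     if value_of st' \<le> cap st then st'\<lparr>level := target st\<rparr>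
     else st'\<lparr>cap := 2 * value_of st', level := 0\<rparr>)"

text \<open>For growing solutions the difference is negative only where a new phase resets the level
  to 0; the truncation then means that nothing is sampled.\<close>

definition hazard :: "'s rounding_state \<Rightarrow> 's rounding_state \<Rightarrow> 's \<Rightarrow> real" where
  "hazard st st' S = max 0 (level st' * sol st' S - level st * sol st S)"

definition candidates :: "('e, 's) frac_arrival \<Rightarrow> 's set" where
  "candidates ob = fst (snd (fst ob))"

definition cheapest :: "('e, 's) frac_arrival \<Rightarrow> 's" where
  "cheapest ob = arg_min_on (snd (snd (fst ob))) (candidates ob)"

text \<open>The private number records whether the cheapest set had to be bought.\<close>

definition complete_cover ::
  "'s rounding_state \<Rightarrow> ('e, 's) frac_arrival \<Rightarrow> 's set \<Rightarrow> nat \<times> 's set" where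
  "complete_cover st ob P =
     (if candidates ob \<inter> (chosen st \<union> P) = {} then (1, insert (cheapest ob) P) else (0, P))"

definition respond :: "'s rounding_state \<Rightarrow> ('e, 's) frac_arrival \<Rightarrow> (nat \<times> 's set) pmf" where
  "respond st ob = (let st' = observe st ob in
     map_pmf (complete_cover st ob)
       (random_subset (known st') (\<lambda>S. 1 - exp (- hazard st st' S))))"

definition after ::
  "'s rounding_state \<Rightarrow> ('e, 's) frac_arrival \<times> nat \<times> 's set \<Rightarrow> 's rounding_state" where
  "after st = (\<lambda>(ob, r, P). let st' = observe st ob in
     st'\<lparr>target := level st' + real r / 2, chosen := chosen st \<union> P\<rparr>)"

text \<open>Algorithms carry no memory, so the state is recomputed from the past. The purchases
  alone do not tell whether the cheapest set was sampled or bought as a repair; the private number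
  does.\<close>

definition rounding :: "(('e, 's) frac_arrival, 's) algorithm" where
  "rounding past = respond (foldl after init_state past)"

section \<open>The potential function\<close>

definition undecided :: "('e, 's) set_system \<Rightarrow> 'e set \<Rightarrow> 's set \<Rightarrow> 'e set" where
  "undecided I E \<C> = {e \<in> ground I - E. containing I e \<inter> \<C> = {}}"

text \<open>The supermartingale Psi, with \<open>target\<close> as M and \<open>level\<close> as
  L.\<close>

definition weight :: "('e, 's) set_system \<Rightarrow> 'e set \<Rightarrow> 's rounding_state \<Rightarrow> real" where
  "weight I E st = exp (target st) +
     (\<Sum>e\<in>undecided I E (chosen st). exp (level st * sum (sol st) (containing I e)))"

text \<open>
  The last summand absorbs the growth of the summand before it when a new phase starts with a
  doubled cap.
\<close>

definition potential :: "('e, 's) set_system \<Rightarrow> 'e set \<Rightarrow> 's rounding_state \<Rightarrow> real" where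
  "potential I E st = total_price I (chosen st) - level st * value_of st
     - 2 * cap st * target st + 3 * cap st * ln (weight I E st)
     - 6 * ln (real (card (ground I)) + 1) * cap st"

definition consistent :: "('e, 's) set_system \<Rightarrow> 'e set \<Rightarrow> 's rounding_state \<Rightarrow> bool" where
  "consistent I E st \<longleftrightarrow> E \<subseteq> ground I \<and> known st = revealed I E \<and> costs st = mask (known st) (price I) \<and>
     (\<forall>S. 0 \<le> sol st S \<and> sol st S \<le> 1) \<and> (\<forall>S. S \<notin> known st \<longrightarrow> sol st S = 0) \<and>
     value_of st \<le> cap st \<and> cap st \<le> 2 * value_of st \<and> 0 \<le> level st \<and> level st \<le> target st \<and>
     chosen st \<subseteq> known st \<and> (\<forall>e\<in>E. containing I e \<inter> chosen st \<noteq> {})"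

lemma revealed_insert: "revealed I (insert e E) = revealed I E \<union> containing I e"
  by (auto simp: revealed_def)

lemma revealed_subset: "revealed I E \<subseteq> family I"
  by (auto simp: revealed_def containing_def)

lemma containing_subset: "containing I e \<subseteq> family I"
  by (auto simp: containing_def)

lemma chosen_in_family: "consistent I E st \<Longrightarrow> chosen st \<subseteq> family I"
  by (metis consistent_def order_trans revealed_subset)

locale finite_set_system =
  fixes I :: "('e, 's) set_system"
  assumes super: "super_instance I"
begin

lemma finite_ground: "finite (ground I)" and finite_family: "finite (family I)"
  and price_nonneg: "S \<in> family I \<Longrightarrow> 0 \<le> price I S"
  using super by (auto simp: super_instance_def)

lemma finite_revealed [simp]: "finite (revealed I E)"
  using finite_subset[OF revealed_subset finite_family] .

lemma finite_containing [simp]: "finite (containing I e)"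
  using finite_subset[OF containing_subset finite_family] .

lemma total_price_nonneg: "\<C> \<subseteq> family I \<Longrightarrow> 0 \<le> total_price I \<C>"
  unfolding total_price_def by (intro sum_nonneg) (auto intro: price_nonneg)

lemma total_price_mono: "\<C> \<subseteq> \<D> \<Longrightarrow> \<D> \<subseteq> family I \<Longrightarrow> total_price I \<C> \<le> total_price I \<D>"
  unfolding total_price_def
  by (intro sum_mono2) (auto intro: price_nonneg finite_subset[OF _ finite_family])

lemma total_price_Un_le:
  assumes "\<C> \<subseteq> family I" "\<D> \<subseteq> family I"
  shows "total_price I (\<C> \<union> \<D>) \<le> total_price I \<C> + total_price I \<D>"
proof -
  have f: "finite \<C>" "finite \<D>" using assms finite_family finite_subset by blast+
  have "0 \<le> sum (price I) (\<C> \<inter> \<D>)" using assms by (intro sum_nonneg price_nonneg) auto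
  then show ?thesis unfolding total_price_def
    using sum.union_inter[OF f, of "price I"] by simp
qed

lemma finite_undecided [simp]: "finite (undecided I E \<C>)"
  using finite_ground by (simp add: undecided_def)

lemma card_undecided: "card (undecided I E \<C>) \<le> card (ground I)"
  by (intro card_mono finite_ground) (auto simp: undecided_def)

lemma weight_ge: "exp (target st) \<le> weight I E st"
  by (simp add: weight_def sum_nonneg)

lemma weight_pos: "0 < weight I E st"
  using weight_ge[of st E] by (smt (verit) exp_gt_zero)

lemma value_of_eq:
  "consistent I E st \<Longrightarrow> value_of st = (\<Sum>S\<in>revealed I E. price I S * sol st S)"
  by (auto simp: value_of_def consistent_def mask_def intro: sum.cong)

lemma value_of_nonneg: "consistent I E st \<Longrightarrow> 0 \<le> value_of st"
  unfolding value_of_eq using revealed_subset[of I E]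
  by (intro sum_nonneg mult_nonneg_nonneg price_nonneg) (auto simp: consistent_def)

text \<open>As \<open>exp (target st)\<close> is a summand of the weight, the logarithmic term is at
  least \<open>3 * cap st * target st\<close>, which outweighs the negative terms with
  \<open>level\<close> (once) and \<open>target\<close> (twice). The constant 12 is 6 times the
  factor in \<open>cap st \<le> 2 * value_of st\<close>.\<close>

lemma potential_ge:
  assumes c: "consistent I E st"
  shows "total_price I (chosen st) - 12 * ln (real (card (ground I)) + 1) * value_of st
    \<le> potential I E st"
proof -
  have V: "0 \<le> value_of st" "value_of st \<le> cap st" "cap st \<le> 2 * value_of st"
    and l: "0 \<le> level st" "level st \<le> target st"
    using c value_of_nonneg[OF c] by (auto simp: consistent_def)
  have "target st \<le> ln (weight I E st)"
    using weight_ge[of st E] weight_pos[of E st] by (simp add: ln_ge_iff)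
  then have "cap st * target st \<le> cap st * ln (weight I E st)"
    using V by (intro mult_left_mono) auto
  moreover have "level st * value_of st \<le> target st * cap st"
    using V l by (intro mult_mono) auto
  moreover have "ln (real (card (ground I)) + 1) * cap st
      \<le> ln (real (card (ground I)) + 1) * (2 * value_of st)"
    using V by (intro mult_left_mono) auto
  ultimately show ?thesis by (simp add: potential_def algebra_simps)
qed

end

section \<open>One arrival and the expected change of the potential\<close>

locale rounding_step = finite_set_system I for I :: "('e, 's) set_system" +
  fixes E :: "'e set" and st :: "'s rounding_state" and e :: 'e and x :: "'s \<Rightarrow> real"
    and E' ob st'
  assumes cons: "consistent I E st"
    and e: "e \<in> ground I"
    and x01: "\<And>S. 0 \<le> x S \<and> x S \<le> 1"
    and x_out: "\<And>S. S \<notin> revealed I (insert e E) \<Longrightarrow> x S = 0"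
    and x_mono: "\<And>S. sol st S \<le> x S"
    and x_cov: "1 \<le> sum x (containing I e)"
  defines "E' \<equiv> insert e E"
    and "ob \<equiv> (arrival I e, x)"
    and "st' \<equiv> observe st ob"
begin

lemma candidates [simp]: "candidates ob = containing I e"
  by (simp add: candidates_def ob_def arrival_def)

lemma st'_simps [simp]:
  "known st' = revealed I E'" "sol st' = x" "chosen st' = chosen st"
  "costs st' = mask (revealed I E') (price I)" "target st' = target st"
  using cons
  by (auto simp: st'_def observe_def Let_def learn_def ob_def arrival_def E'_def revealed_insert
      consistent_def mask_def fun_eq_iff)

lemma value': "value_of st' = (\<Sum>S\<in>revealed I E'. price I S * x S)"
  by (auto simp: value_of_def mask_def intro: sum.cong)

lemma value_learn: "value_of (learn st ob) = value_of st'"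
  by (auto simp: value_of_def st'_def observe_def Let_def)

lemma cap_level:
  "cap st' = (if value_of st' \<le> cap st then cap st else 2 * value_of st')"
  "level st' = (if value_of st' \<le> cap st then target st else 0)"
  using value_learn by (auto simp: st'_def observe_def Let_def learn_def ob_def split: prod.splits)

lemma level'_nonneg: "0 \<le> level st'"
  using cons by (auto simp: cap_level consistent_def)

lemma price_revealed: "S \<in> revealed I E' \<Longrightarrow> 0 \<le> price I S"
  by (rule price_nonneg[OF subsetD[OF revealed_subset]])

text \<open>Newly revealed sets had value 0 before, so the old value can be summed over the new
  index set and compared with the new value term by term.\<close>

lemma old_value: "value_of st = (\<Sum>S\<in>revealed I E'. price I S * sol st S)"
  unfolding value_of_eq[OF cons] using cons
  by (intro sum.mono_neutral_left) (auto simp: E'_def revealed_insert consistent_def)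

lemma value_mono: "value_of st \<le> value_of st'"
  unfolding value' old_value by (intro sum_mono mult_left_mono x_mono price_revealed)

lemma containing_nonempty: "containing I e \<noteq> {}"
  using x_cov by auto

lemma cheapest_in: "cheapest ob \<in> containing I e"
  and cheapest_le: "S \<in> containing I e \<Longrightarrow> price I (cheapest ob) \<le> price I S"
proof -
  have eq: "cheapest ob = arg_min_on (mask (containing I e) (price I)) (containing I e)"
    by (simp add: cheapest_def) (simp add: ob_def arrival_def)
  show in1: "cheapest ob \<in> containing I e"
    unfolding eq by (intro arg_min_if_finite containing_nonempty) simp
  show "price I (cheapest ob) \<le> price I S" if "S \<in> containing I e"
    using arg_min_least[OF finite_containing containing_nonempty that,
      of "mask (containing I e) (price I)"] in1 that
    unfolding eq[symmetric] by (simp add: mask_def)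
qed

text \<open>The sets containing \<open>e\<close> carry total fractional weight at least 1, and none
  of them is cheaper than the cheapest; so a repair costs no more than the fractional solution
  itself.\<close>

lemma cheapest_le_value: "price I (cheapest ob) \<le> value_of st'"
proof -
  have "price I (cheapest ob) * 1 \<le> price I (cheapest ob) * sum x (containing I e)"
    using x_cov cheapest_in containing_subset[of I e] by (intro mult_left_mono price_nonneg) auto
  also have "\<dots> \<le> (\<Sum>S\<in>containing I e. price I S * x S)"
    unfolding sum_distrib_left by (intro sum_mono mult_right_mono cheapest_le) (use x01 in auto)
  also have "\<dots> \<le> value_of st'"
    unfolding value' using x01
    by (intro sum_mono2) (auto simp: E'_def revealed_insert intro!: mult_nonneg_nonneg
        price_nonneg[OF subsetD[OF revealed_subset]])
  finally show ?thesis by simp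
qed

abbreviation "sample \<equiv> random_subset (revealed I E') (\<lambda>S. 1 - exp (- hazard st st' S))"

lemma respond_eq: "respond st ob = map_pmf (complete_cover st ob) sample"
  by (simp add: respond_def Let_def flip: st'_def)

lemma hazard_nonneg: "0 \<le> hazard st st' S"
  by (simp add: hazard_def)

text \<open>Within a phase the bound telescopes against the term
  \<open>level st * value_of st\<close> of the potential; at the start of a phase nothing is
  sampled.\<close>

lemma expected_price:
  "measure_pmf.expectation sample (total_price I)
    \<le> (if value_of st' \<le> cap st then target st * value_of st' - level st * value_of st else 0)"
proof -
  have "measure_pmf.expectation sample (total_price I)
      = (\<Sum>S\<in>revealed I E'. price I S * (1 - exp (- hazard st st' S)))"
    unfolding total_price_def
    by (intro expectation_random_subset) (auto simp: hazard_nonneg)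
  also have "\<dots> \<le> (\<Sum>S\<in>revealed I E'. price I S * hazard st st' S)"
  proof (intro sum_mono mult_left_mono price_revealed)
    show "1 - exp (- hazard st st' S) \<le> hazard st st' S" for S
      using exp_ge_add_one_self[of "- hazard st st' S"] by linarith
  qed
  also have "\<dots> = (if value_of st' \<le> cap st then target st * value_of st' - level st * value_of st else 0)"
  proof (cases "value_of st' \<le> cap st")
    case True
    \<comment> \<open>Level and solution both grow within a phase, so the truncation in
      \<open>hazard\<close> is inactive.\<close>
    have "hazard st st' S = target st * x S - level st * sol st S" for S
    proof -
      have "level st * sol st S \<le> target st * x S"
        using cons x_mono by (intro mult_mono) (auto simp: consistent_def)
      then show ?thesis using True by (simp add: hazard_def cap_level)
    qed
    then have "(\<Sum>S\<in>revealed I E'. price I S * hazard st st' S) =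
        (\<Sum>S\<in>revealed I E'. target st * (price I S * x S) - level st * (price I S * sol st S))"
      by (intro sum.cong refl) (simp only: right_diff_distrib mult.left_commute)
    then show ?thesis using True unfolding value' old_value sum_distrib_left sum_subtractf by simp
  next
    case False
    have "hazard st st' S = 0" for S
    proof -
      have "0 \<le> level st * sol st S" using cons by (simp add: consistent_def)
      then show ?thesis using False by (simp add: hazard_def cap_level)
    qed
    then show ?thesis using False by simp
  qed
  finally show ?thesis .
qed

lemma in_sample: "P \<in> set_pmf sample \<Longrightarrow> P \<subseteq> revealed I E'"
  by (rule set_random_subset)

lemma finite_sample: "finite (set_pmf sample)"
  by (rule finite_random_subset) simp

lemma after_simps [simp]:
  "known (after st (ob, r, Q)) = revealed I E'" "sol (after st (ob, r, Q)) = x"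
  "costs (after st (ob, r, Q)) = mask (revealed I E') (price I)"
  "cap (after st (ob, r, Q)) = cap st'" "level (after st (ob, r, Q)) = level st'"
  "target (after st (ob, r, Q)) = level st' + real r / 2"
  "chosen (after st (ob, r, Q)) = chosen st \<union> Q"
  "value_of (after st (ob, r, Q)) = value_of st'"
  by (simp_all add: after_def Let_def value_of_def flip: st'_def)

lemma after_consistent:
  assumes "(r, Q) \<in> set_pmf (respond st ob)"
  shows "consistent I E' (after st (ob, r, Q))" "Q \<subseteq> revealed I E'"
proof -
  from assms obtain P where P: "P \<subseteq> revealed I E'" "(r, Q) = complete_cover st ob P"
    using in_sample unfolding respond_eq by auto
  show Q: "Q \<subseteq> revealed I E'"
    using P cheapest_in by (auto simp: complete_cover_def E'_def revealed_insert split: if_splits)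
  have "containing I e \<inter> (chosen st \<union> Q) \<noteq> {}"
    using P cheapest_in by (auto simp: complete_cover_def split: if_splits)
  \<comment> \<open>The bound \<open>cap st' \<le> 2 * value_of st'\<close> persists within a phase
    because values only grow, and is an equality at the start of a phase.\<close>
  then show "consistent I E' (after st (ob, r, Q))"
    using cons e x01 x_out Q value_mono value_of_nonneg[OF cons] unfolding consistent_def after_simps
    by (auto simp: cap_level E'_def revealed_insert)
qed

text \<open>The weight between the two purchases of one arrival: \<open>P\<close> has been sampled
  at the new level, but \<open>e\<close> is not yet among the arrived elements and no repair has
  been made.\<close>

definition survivors :: "'s set \<Rightarrow> real" where "survivors P = exp (level st') +
  (\<Sum>e'\<in>undecided I E (chosen st). if containing I e' \<inter> P = {} then exp (level st' * sum x (containing I e')) else 0)"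

text \<open>
  When \<open>e\<close> has to be bought, its own term in the sum pays for the growth of the first summand.
\<close>

lemma weight_after_le:
  assumes "complete_cover st ob P = (r, Q)"
  shows "weight I E' (after st (ob, r, Q)) \<le> survivors P"
proof -
  let ?f = "\<lambda>e'. exp (level st' * sum x (containing I e'))"
  have surv: "survivors P = exp (level st') + sum ?f (undecided I E (chosen st \<union> P))"
    unfolding survivors_def sum.inter_filter[OF finite_undecided, symmetric]
    by (intro arg_cong2[where f = "(+)"] sum.cong refl) (auto simp: undecided_def)
  show ?thesis
  proof (cases "containing I e \<inter> (chosen st \<union> P) = {}")
    case True
    then have rQ: "r = 1" "Q = insert (cheapest ob) P"
      using assms by (auto simp: complete_cover_def)
    \<comment> \<open>Earlier arrivals are already covered by consistency, so an uncovered
      \<open>e\<close> is new and has its own term in the sum.\<close>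
    have "e \<notin> E" using True cons by (auto simp: consistent_def)
    then have e_in: "e \<in> undecided I E (chosen st \<union> P)" using True e by (auto simp: undecided_def)
    \<comment> \<open>The increment 1/2 of the level lets the first summand at most double. Its
      growth is then at most the term of \<open>e\<close>, whose coverage is at least 1.\<close>
    have half: "exp (1/2) \<le> (2::real)"
      using exp_le by (simp add: exp_half_le2)
    have "exp (level st' + real r / 2) \<le> exp (level st') + exp (level st')"
      using mult_left_mono[OF half, of "exp (level st')"] by (simp add: rQ exp_add)
    moreover have "exp (level st') \<le> ?f e"
      using level'_nonneg x_cov mult_left_mono[of 1 "sum x (containing I e)" "level st'"] by simp
    moreover have "sum ?f (undecided I E' (chosen st \<union> Q)) \<le> sum ?f (undecided I E (chosen st \<union> P) - {e})"
      by (intro sum_mono2) (auto simp: undecided_def rQ E'_def finite_ground)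
    moreover have "\<dots> = sum ?f (undecided I E (chosen st \<union> P)) - ?f e"
      using e_in by (simp add: sum_diff1)
    ultimately show ?thesis unfolding surv weight_def after_simps by linarith
  next
    case False
    then have "r = 0" "Q = P" using assms by (auto simp: complete_cover_def)
    then show ?thesis unfolding surv weight_def after_simps
      by (auto simp: undecided_def E'_def finite_ground intro!: sum_mono2)
  qed
qed

lemma survivors_pos: "0 < survivors P"
  unfolding survivors_def by (intro add_pos_nonneg sum_nonneg) auto

text \<open>The hazards collected by an element are at least the growth of level times coverage in
  its exponent, so its survival probability makes up for the growth of its term, for each element
  separately.\<close>

lemma expected_survivors:
  assumes "value_of st' \<le> cap st"
  shows "measure_pmf.expectation sample survivors \<le> weight I E st"
proof -
  let ?f = "\<lambda>e'. exp (level st' * sum x (containing I e'))"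
  let ?U = "undecided I E (chosen st)"
  have L: "level st' = target st" using assms by (simp add: cap_level)
  have int: "integrable (measure_pmf sample) f" for f :: "_ \<Rightarrow> real"
    by (intro integrable_measure_pmf_finite finite_sample)
  have "measure_pmf.expectation sample survivors = measure_pmf.expectation sample (\<lambda>P. exp (level st') +
      (\<Sum>e'\<in>?U. ?f e' * (if containing I e' \<inter> P = {} then 1 else 0)))"
    unfolding survivors_def
    by (intro Bochner_Integration.integral_cong arg_cong2[where f = "(+)"] sum.cong refl) auto
  also have "\<dots> = exp (level st') +
      (\<Sum>e'\<in>?U. measure_pmf.expectation sample (\<lambda>P. ?f e' * (if containing I e' \<inter> P = {} then 1 else 0)))"
    by (subst Bochner_Integration.integral_add[OF int int], subst Bochner_Integration.integral_sum[OF int]) simp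
  also have "\<dots> \<le> weight I E st"
    unfolding weight_def L
  proof (intro add_left_mono sum_mono)
    fix e' assume "e' \<in> ?U"
    \<comment> \<open>Only revealed sets can be sampled. The other sets containing \<open>e'\<close>
      have value 0 in both solutions, so the restriction loses no coverage.\<close>
    let ?B = "containing I e' \<inter> revealed I E'"
    have "measure_pmf.expectation sample (\<lambda>P. exp (target st * sum x (containing I e')) *
        (if containing I e' \<inter> P = {} then 1 else 0))
      = exp (target st * sum x (containing I e')) *
        measure_pmf.expectation sample (\<lambda>P. if ?B \<inter> P = {} then 1 else 0)"
      unfolding integral_mult_right_zero[symmetric]
      by (intro integral_cong_AE) (auto simp: AE_measure_pmf_iff dest!: in_sample)
    also have "\<dots> = exp (target st * sum x (containing I e')) * exp (- (\<Sum>S\<in>?B. hazard st st' S))"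
      by (subst prob_random_subset_disjoint) (auto simp: hazard_nonneg)
    also have "\<dots> = exp (target st * sum x (containing I e') - (\<Sum>S\<in>?B. hazard st st' S))"
      by (simp add: exp_diff exp_minus divide_inverse)
    also have "\<dots> \<le> exp (level st * sum (sol st) (containing I e'))"
    proof -
      have "(\<Sum>S\<in>containing I e'. target st * x S - level st * sol st S)
          = (\<Sum>S\<in>?B. target st * x S - level st * sol st S)"
        using x_out cons by (intro sum.mono_neutral_right)
          (auto simp: consistent_def E'_def revealed_insert)
      also have "\<dots> \<le> (\<Sum>S\<in>?B. hazard st st' S)"
        by (intro sum_mono) (simp add: hazard_def L)
      finally show ?thesis by (simp add: sum_subtractf sum_distrib_left)
    qed
    finally show "measure_pmf.expectation sample (\<lambda>P. exp (target st * sum x (containing I e')) *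
        (if containing I e' \<inter> P = {} then 1 else 0)) \<le> exp (level st * sum (sol st) (containing I e'))" .
  qed
  finally show ?thesis .
qed

lemma price_after_le:
  assumes "P \<in> set_pmf sample" "complete_cover st ob P = (r, Q)"
  shows "total_price I (chosen st \<union> Q) \<le> total_price I (chosen st) + total_price I P + real r * cap st'"
proof -
  have sub: "chosen st \<subseteq> family I" "P \<subseteq> family I" "cheapest ob \<in> family I"
    using chosen_in_family[OF cons] order_trans[OF in_sample[OF assms(1)] revealed_subset]
      subsetD[OF containing_subset cheapest_in]
    by simp_all
  have c: "value_of st' \<le> cap st'"
    using value_mono value_of_nonneg[OF cons] by (auto simp: cap_level)
  have *: "total_price I (chosen st \<union> P) \<le> total_price I (chosen st) + total_price I P"
    using sub by (intro total_price_Un_le) auto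
  show ?thesis
  proof (cases "r = 0")
    case True
    with assms have "Q = P" by (auto simp: complete_cover_def split: if_splits)
    with True * show ?thesis by simp
  next
    case False
    with assms have Q: "r = 1" "Q = insert (cheapest ob) P" by (auto simp: complete_cover_def split: if_splits)
    have "total_price I (chosen st \<union> Q) \<le> total_price I {cheapest ob} + total_price I (chosen st \<union> P)"
      using sub total_price_Un_le[of "{cheapest ob}" "chosen st \<union> P"] by (simp add: Q)
    moreover have "total_price I {cheapest ob} \<le> cap st'"
      using cheapest_le_value c by (simp add: total_price_def)
    ultimately show ?thesis using * Q by simp
  qed
qed

text \<open>Within a phase, sampling is paid for by the term with \<open>level\<close>, and a repair
  raises \<open>target\<close> by 1/2 and so releases exactly \<open>cap st'\<close>, while the
  logarithm does not grow in expectation. At the start of a phase the payment comes from the last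
  term of the potential.\<close>

lemma expected_potential_le:
  "measure_pmf.expectation (respond st ob) (\<lambda>(r, Q). potential I E' (after st (ob, r, Q)))
    \<le> potential I E st"
proof -
  define lam where "lam = ln (real (card (ground I)) + 1)"
  have cap: "0 \<le> cap st" "0 \<le> cap st'"
    using cons value_mono value_of_nonneg[OF cons] by (auto simp: cap_level consistent_def)
  have pointwise: "potential I E' (after st (ob, complete_cover st ob P)) \<le>
      total_price I (chosen st) + total_price I P - level st' * value_of st'
      - 2 * cap st' * level st' + 3 * cap st' * ln (survivors P) - 6 * lam * cap st'"
    if P: "P \<in> set_pmf sample" for P
  proof -
    obtain r Q where rQ: "complete_cover st ob P = (r, Q)" by fastforce
    have "ln (weight I E' (after st (ob, r, Q))) \<le> ln (survivors P)"
      using weight_after_le[OF rQ] weight_pos survivors_pos by simp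
    then have "3 * cap st' * ln (weight I E' (after st (ob, r, Q))) \<le> 3 * cap st' * ln (survivors P)"
      using cap by (intro mult_left_mono) auto
    then show ?thesis
      using price_after_le[OF P rQ] by (simp add: rQ potential_def lam_def algebra_simps)
  qed
  have int: "integrable (measure_pmf sample) f" for f :: "_ \<Rightarrow> real"
    by (intro integrable_measure_pmf_finite finite_sample)
  have "measure_pmf.expectation (respond st ob) (\<lambda>(r, Q). potential I E' (after st (ob, r, Q)))
      = measure_pmf.expectation sample (\<lambda>P. potential I E' (after st (ob, complete_cover st ob P)))"
    by (simp add: respond_eq case_prod_unfold)
  also have "\<dots> \<le> potential I E st"
  proof (cases "value_of st' \<le> cap st")
    case True
    let ?W = "weight I E st"
    let ?c = "total_price I (chosen st) - target st * value_of st' - 2 * cap st * target st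
          - 6 * lam * cap st + 3 * cap st * (ln ?W - 1)"
    have L: "level st' = target st" "cap st' = cap st" using True by (auto simp: cap_level)
    have "measure_pmf.expectation sample (\<lambda>P. potential I E' (after st (ob, complete_cover st ob P)))
        \<le> measure_pmf.expectation sample (\<lambda>P. total_price I P + 3 * cap st / ?W * survivors P + ?c)"
    proof (intro integral_mono_AE int)
      have "potential I E' (after st (ob, complete_cover st ob P))
          \<le> total_price I P + 3 * cap st / ?W * survivors P + ?c" if P: "P \<in> set_pmf sample" for P
      proof -
        \<comment> \<open>The tangent of \<open>ln\<close> at the old weight does the work of
          Jensen's inequality: the bound is linear in \<open>survivors P\<close>, so
          \<open>expected_survivors\<close> can be inserted.\<close>
        have "ln (survivors P) \<le> ln ?W + survivors P / ?W - 1"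
          using ln_le_minus_one[of "survivors P / ?W"] weight_pos[of E st] survivors_pos[of P]
          by (simp add: ln_div)
        then have "3 * cap st * ln (survivors P) \<le> 3 * cap st * (ln ?W + survivors P / ?W - 1)"
          using cap by (intro mult_left_mono) auto
        then show ?thesis using pointwise[OF P] L by (simp add: algebra_simps)
      qed
      then show "AE P in sample. potential I E' (after st (ob, complete_cover st ob P))
          \<le> total_price I P + 3 * cap st / ?W * survivors P + ?c"
        by (simp add: AE_measure_pmf_iff)
    qed
    also have "\<dots> = measure_pmf.expectation sample (total_price I)
        + 3 * cap st / ?W * measure_pmf.expectation sample survivors + ?c"
      by (simp add: int del: integral_mult_right_zero sum_distrib_left)
    also have "\<dots> \<le> (target st * value_of st' - level st * value_of st) + 3 * cap st / ?W * ?W + ?c"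
      using expected_price True expected_survivors[OF True] cap weight_pos[of E st]
      by (intro add_right_mono add_mono mult_left_mono) (auto intro!: divide_nonneg_pos)
    also have "\<dots> = potential I E st"
      using weight_pos[of E st] by (simp add: potential_def lam_def algebra_simps)
    finally show ?thesis .
  next
    case False
    have L: "level st' = 0" "cap st' = 2 * value_of st'" using False by (auto simp: cap_level)
    have "measure_pmf.expectation sample (\<lambda>P. potential I E' (after st (ob, complete_cover st ob P)))
        \<le> measure_pmf.expectation sample (\<lambda>P. total_price I P + (total_price I (chosen st) - 3 * lam * cap st'))"
    proof (intro integral_mono_AE int)
      have "potential I E' (after st (ob, complete_cover st ob P))
          \<le> total_price I P + (total_price I (chosen st) - 3 * lam * cap st')" if P: "P \<in> set_pmf sample" for P
      proof -
        \<comment> \<open>At level 0 every exponential equals 1, so the weight is at most the number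
          of elements plus one.\<close>
        have "survivors P \<le> 1 + (\<Sum>e'\<in>undecided I E (chosen st). 1)"
          unfolding L survivors_def by (intro add_mono sum_mono) auto
        also have "\<dots> \<le> real (card (ground I)) + 1" using card_undecided by simp
        finally have "ln (survivors P) \<le> lam"
          using survivors_pos[of P] by (simp add: lam_def)
        then have "3 * cap st' * ln (survivors P) \<le> 3 * cap st' * lam"
          using cap by (intro mult_left_mono) auto
        then show ?thesis using pointwise[OF P] L by (simp add: algebra_simps)
      qed
      then show "AE P in sample. potential I E' (after st (ob, complete_cover st ob P))
          \<le> total_price I P + (total_price I (chosen st) - 3 * lam * cap st')"
        by (simp add: AE_measure_pmf_iff)
    qed
    also have "\<dots> \<le> total_price I (chosen st) - 3 * lam * cap st'"
      using expected_price False by (simp add: int)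
    \<comment> \<open>Of \<open>6 * lam * cap st'\<close>, half has been spent on the logarithm. As
      the cap at least doubles, the other half still covers \<open>6 * lam * cap st\<close>; this
      fixes the coefficient 6.\<close>
    also have "\<dots> \<le> total_price I (chosen st) - 3 * lam * (2 * cap st)"
      using False by (intro diff_left_mono mult_left_mono) (auto simp: L lam_def)
    also have "\<dots> \<le> potential I E st"
    proof -
      have "target st \<le> ln (weight I E st)"
        using weight_ge[of st E] weight_pos[of E st] by (simp add: ln_ge_iff)
      then have "cap st * target st \<le> cap st * ln (weight I E st)"
        using cap by (intro mult_left_mono) auto
      moreover have "level st * value_of st \<le> target st * cap st"
        using cons value_of_nonneg[OF cons] by (intro mult_mono) (auto simp: consistent_def)
      ultimately show ?thesis by (simp add: potential_def lam_def algebra_simps)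
    qed
    finally show ?thesis .
  qed
  finally show ?thesis .
qed

end

section \<open>Legality and coverage when a sequence is extended\<close>

lemma fst_set_snoc: "fst ` set (ms @ [m]) = insert (fst m) (fst ` set ms)"
  by simp

lemma frac_legal_Nil [simp]: "frac_legal I []"
  by (simp add: frac_legal_def)

text \<open>Monotonicity against the latest solution gives monotonicity against all earlier ones by
  transitivity, so legality becomes a condition on single steps.\<close>

lemma frac_legal_snoc:
  "frac_legal I (ms @ [m]) \<longleftrightarrow> frac_legal I ms \<and> fst m \<in> ground I \<and>
     (\<forall>S\<in>family I. 0 \<le> snd m S \<and> snd m S \<le> 1) \<and>
     (ms \<noteq> [] \<longrightarrow> (\<forall>S\<in>family I. snd (last ms) S \<le> snd m S)) \<and>
     frac_feasible I (snd m) (insert (fst m) (fst ` set ms))" (is "?L \<longleftrightarrow> ?R")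
proof
  assume L: ?L
  have "frac_legal I ms" unfolding frac_legal_def
  proof (intro allI impI)
    fix k assume k: "k < length ms"
    then have k': "k < length (ms @ [m])" by simp
    show "fst (ms ! k) \<in> ground I \<and> (\<forall>S\<in>family I. snd (ms ! k) S \<in> {0..1}) \<and>
        (\<forall>j\<le>k. \<forall>S\<in>family I. snd (ms ! j) S \<le> snd (ms ! k) S) \<and>
        frac_feasible I (snd (ms ! k)) (fst ` set (take (Suc k) ms))"
      using L[unfolded frac_legal_def, rule_format, OF k'] k
      by (auto simp: nth_append split: if_splits)
  qed
  moreover have "length ms < length (ms @ [m])" by simp
  note last = L[unfolded frac_legal_def, rule_format, OF this]
  have "snd (last ms) S \<le> snd m S" if "ms \<noteq> []" "S \<in> family I" for S
    using last that by (auto simp: last_conv_nth nth_append dest!: spec[of _ "length ms - 1"])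
  ultimately show ?R using last by simp
next
  assume R: ?R
  show ?L unfolding frac_legal_def
  proof (intro allI impI)
    fix k assume k: "k < length (ms @ [m])"
    show "fst ((ms @ [m]) ! k) \<in> ground I \<and> (\<forall>S\<in>family I. snd ((ms @ [m]) ! k) S \<in> {0..1}) \<and>
        (\<forall>j\<le>k. \<forall>S\<in>family I. snd ((ms @ [m]) ! j) S \<le> snd ((ms @ [m]) ! k) S) \<and>
        frac_feasible I (snd ((ms @ [m]) ! k)) (fst ` set (take (Suc k) (ms @ [m])))"
    proof (cases "k < length ms")
      case True
      then show ?thesis using R[THEN conjunct1, unfolded frac_legal_def, rule_format, OF True]
        by (auto simp: nth_append)
    next
      case False
      then have k: "k = length ms" using k by simp
      have "snd ((ms @ [m]) ! j) S \<le> snd m S" if "j \<le> k" "S \<in> family I" for j S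
      proof (cases "j < length ms")
        case True
        then have "length ms - 1 < length ms" "j \<le> length ms - 1" by auto
        then have "snd (ms ! j) S \<le> snd (ms ! (length ms - 1)) S"
          using R that unfolding frac_legal_def by blast
        also have "\<dots> \<le> snd m S"
          using R that True by (auto simp: last_conv_nth)
        finally show ?thesis using True by (simp add: nth_append)
      next
        case False
        then show ?thesis using that k by simp
      qed
      then show ?thesis using R k by (simp add: nth_append)
    qed
  qed
qed

lemma covers_online_snoc:
  assumes "length Ps = length es"
  shows "covers_online I (es @ [e]) (Ps @ [P]) \<longleftrightarrow> covers_online I es Ps \<and>
    \<Union> (set Ps) \<union> P \<subseteq> revealed I (insert e (set es)) \<and>
    covers I (\<Union> (set Ps) \<union> P) (insert e (set es))"
proof -
  have "{..length (es @ [e])} = insert (Suc (length es)) {..length es}" by auto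
  then have "(\<forall>k\<le>length (es @ [e]). Q k) \<longleftrightarrow> (\<forall>k\<le>length es. Q k) \<and> Q (Suc (length es))" for Q
    by (auto simp: le_Suc_eq)
  then show ?thesis unfolding covers_online_def Let_def using assms
    by (simp add: Un_commute) blast
qed

section \<open>The rounding algorithm along whole plays\<close>

definition state_of :: "('e, 's) set_system \<Rightarrow> (('e, 's) frac_move, 's) transcript \<Rightarrow> 's rounding_state" where
  "state_of I h = foldl after init_state (algorithm_view (frac_obs I) h)"

lemma state_of_snoc:
  "state_of I (h @ [(m, r, P)]) = after (state_of I h) (frac_obs I (moves h @ [m]), r, P)"
  by (simp add: state_of_def)

definition rounding_inv :: "('e, 's) set_system \<Rightarrow> (('e, 's) frac_move, 's) transcript \<Rightarrow> bool" where
  "rounding_inv I h \<longleftrightarrow> frac_legal I (moves h) \<and>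
     covers_online I (map fst (moves h)) (purchases h) \<and>
     consistent I (fst ` set (moves h)) (state_of I h) \<and>
     sol (state_of I h) =
       (if h = [] then (\<lambda>_. 0) else mask (revealed I (fst ` set (moves h))) (snd (last (moves h)))) \<and>
     chosen (state_of I h) = bought h"

context finite_set_system
begin

lemma rounding_inv_Nil: "rounding_inv I []"
  by (simp add: rounding_inv_def covers_online_def covers_def revealed_def consistent_def
      state_of_def init_state_def value_of_def mask_def)

lemma rounding_step_of_inv:
  assumes inv: "rounding_inv I h" and legal: "frac_legal I (moves h @ [m])"
  shows "rounding_step I (fst ` set (moves h)) (state_of I h) (fst m)
    (mask (revealed I (insert (fst m) (fst ` set (moves h)))) (snd m))"
proof
  note L = legal[unfolded frac_legal_snoc]
  note inv' = inv[unfolded rounding_inv_def]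
  let ?R = "revealed I (insert (fst m) (fst ` set (moves h)))"
  show "consistent I (fst ` set (moves h)) (state_of I h)" using inv' by simp
  show "fst m \<in> ground I" using L by simp
  show "0 \<le> mask ?R (snd m) S \<and> mask ?R (snd m) S \<le> 1" for S
    using L by (auto simp: mask_def dest: subsetD[OF revealed_subset])
  show "mask ?R (snd m) S = 0" if "S \<notin> revealed I (insert (fst m) (fst ` set (moves h)))" for S
    using that by (simp add: mask_def)
  show "sol (state_of I h) S \<le> mask ?R (snd m) S" for S
  proof (cases "S \<in> ?R")
    case True
    then have "S \<in> family I" by (rule subsetD[OF revealed_subset])
    moreover have "moves h \<noteq> []" if "h \<noteq> []" using that by (simp add: moves_def)
    ultimately show ?thesis using inv' L True by (auto simp: mask_def)
  next
    case False
    then have "S \<notin> revealed I (fst ` set (moves h))" by (auto simp: revealed_def)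
    then show ?thesis using inv' False by (simp add: mask_def)
  qed
  have "sum (mask ?R (snd m)) (containing I (fst m)) = sum (snd m) (containing I (fst m))"
    by (intro sum.cong) (auto simp: mask_def revealed_def)
  then show "1 \<le> sum (mask ?R (snd m)) (containing I (fst m))"
    using L by (simp add: frac_feasible_def)
qed

lemma frac_obs_snoc: "frac_obs I (ms @ [m]) =
  (arrival I (fst m), mask (revealed I (insert (fst m) (fst ` set ms))) (snd m))"
  by (simp add: frac_obs_def)

lemma rounding_inv_step:
  assumes inv: "rounding_inv I h" and legal: "frac_legal I (moves h @ [m])"
    and rP: "(r, P) \<in> set_pmf (rounding (algorithm_view (frac_obs I) h) (frac_obs I (moves h @ [m])))"
  shows "rounding_inv I (h @ [(m, r, P)])"
proof -
  let ?x = "mask (revealed I (insert (fst m) (fst ` set (moves h)))) (snd m)"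
  interpret rounding_step I "fst ` set (moves h)" "state_of I h" "fst m" ?x
    "insert (fst m) (fst ` set (moves h))" "(arrival I (fst m), ?x)"
    "observe (state_of I h) (arrival I (fst m), ?x)"
    using rounding_step_of_inv[OF inv legal] .
  have rP': "(r, P) \<in> set_pmf (respond (state_of I h) (arrival I (fst m), ?x))"
    using rP unfolding rounding_def state_of_def frac_obs_snoc .
  note new = after_consistent[OF rP']
  note inv' = inv[unfolded rounding_inv_def]
  have st: "state_of I (h @ [(m, r, P)]) = after (state_of I h) ((arrival I (fst m), ?x), r, P)"
    by (simp add: state_of_snoc frac_obs_snoc)
  have ch: "chosen (state_of I h) \<union> P = bought h \<union> P" using inv' by simp
  have sub: "bought h \<union> P \<subseteq> revealed I (insert (fst m) (fst ` set (moves h)))"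
    using new(1) unfolding consistent_def by (simp add: ch)
  have "covers I (bought h \<union> P) (insert (fst m) (fst ` set (moves h)))"
    unfolding covers_def
  proof
    show "bought h \<union> P \<subseteq> family I" using sub revealed_subset by (rule order_trans)
    have "containing I e' \<inter> (bought h \<union> P) \<noteq> {}" if "e' \<in> insert (fst m) (fst ` set (moves h))" for e'
      using new(1) that unfolding consistent_def after_simps ch by blast
    then show "insert (fst m) (fst ` set (moves h)) \<subseteq> (\<Union>S\<in>bought h \<union> P. members I S)"
      unfolding containing_def by blast
  qed
  then have "covers_online I (map fst (moves h) @ [fst m]) (purchases h @ [P])"
    using sub inv' by (simp add: covers_online_snoc bought_def[symmetric])
  then show ?thesis
    unfolding rounding_inv_def st
    using legal new(1) inv' by (simp add: ch)
qed

text \<open>The adversary may also put weight on sets not revealed so far, which the algorithm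
  cannot see; they only add to the right-hand side.\<close>

lemma value_le_frac_cost:
  assumes "rounding_inv I h"
  shows "value_of (state_of I h) \<le> frac_cost I (moves h)"
proof (cases "h = []")
  case True
  then show ?thesis by (simp add: state_of_def init_state_def value_of_def frac_cost_def)
next
  case False
  note inv = assms[unfolded rounding_inv_def]
  obtain ms m where ms: "moves h = ms @ [m]" using False
    by (metis length_moves length_0_conv rev_exhaust)
  let ?R = "revealed I (fst ` set (moves h))"
  have "value_of (state_of I h) = (\<Sum>S\<in>?R. price I S * snd m S)"
    using inv False by (subst value_of_eq) (auto simp: ms mask_def intro!: sum.cong)
  also have "\<dots> \<le> (\<Sum>S\<in>family I. price I S * snd m S)"
    using inv by (intro sum_mono2 finite_family revealed_subset mult_nonneg_nonneg)
      (auto simp: ms frac_legal_snoc price_nonneg)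
  finally show ?thesis by (simp add: frac_cost_def ms)
qed

lemma frac_cost_bounds:
  assumes "frac_legal I ms"
  shows "0 \<le> frac_cost I ms" "frac_cost I ms \<le> total_price I (family I)"
proof -
  have "0 \<le> frac_cost I ms \<and> frac_cost I ms \<le> total_price I (family I)"
  proof (cases ms rule: rev_exhaust)
    case Nil
    then show ?thesis by (simp add: frac_cost_def total_price_nonneg)
  next
    case (snoc ms' m)
    then show ?thesis using assms unfolding total_price_def
      by (auto simp: frac_cost_def frac_legal_snoc price_nonneg
          intro!: sum_nonneg sum_mono mult_left_le)
  qed
  then show "0 \<le> frac_cost I ms" "frac_cost I ms \<le> total_price I (family I)" by auto
qed

lemma bought_in_family: "rounding_inv I h \<Longrightarrow> bought h \<subseteq> family I"
  using chosen_in_family unfolding rounding_inv_def by metis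

text \<open>The final fractional cost depends on the random purchases, so it belongs under the
  expectation: price minus scaled fractional cost stays below the potential, which starts at
  0.\<close>

lemma rounding_cost:
  fixes D :: "(('e, 's) frac_move, 's) adversary" and T :: nat
  assumes obeys: "obeys D (frac_legal I)"
  defines "p \<equiv> play (frac_obs I) rounding D T"
  shows "\<And>h. h \<in> set_pmf p \<Longrightarrow> rounding_inv I h"
    and "integrable (measure_pmf p) (\<lambda>h. frac_cost I (moves h))"
    and "measure_pmf.expectation p (\<lambda>h. total_price I (bought h))
      \<le> 12 * ln (real (card (ground I)) + 1) * measure_pmf.expectation p (\<lambda>h. frac_cost I (moves h))"
proof -
  let ?lam = "12 * ln (real (card (ground I)) + 1)"
  let ?W = "total_price I (family I)"
  have legal: "frac_legal I (moves h @ [m])"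
    if "rounding_inv I h" "Some m \<in> set_pmf (D (adversary_view h))" for h m
    using obeys that unfolding obeys_def rounding_inv_def
    by (metis map_fst_adversary_view)
  have step: "rounding_inv I (h @ [(m, r, P)])"
    if "rounding_inv I h" "Some m \<in> set_pmf (D (adversary_view h))"
      "(r, P) \<in> set_pmf (rounding (algorithm_view (frac_obs I) h) (frac_obs I (moves h @ [m])))"
    for h m r P
    using rounding_inv_step legal that by blast
  show inv: "rounding_inv I h" if "h \<in> set_pmf p" for h
    using continue_play_invariant[where Inv = "rounding_inv I", OF step rounding_inv_Nil] that
    unfolding p_def play_def by blast
  \<comment> \<open>Both costs are bounded by the price of the whole family; this yields
    integrability and the constant \<open>K\<close>.\<close>
  have price: "\<bar>total_price I (bought h)\<bar> \<le> ?W" if "rounding_inv I h" for h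
    using bought_in_family[OF that] total_price_mono[of "bought h" "family I"]
    by (simp add: total_price_nonneg)
  have cost: "\<bar>frac_cost I (moves h)\<bar> \<le> ?W" if "rounding_inv I h" for h
    using that frac_cost_bounds[of "moves h"] by (simp add: rounding_inv_def)
  show int: "integrable (measure_pmf p) (\<lambda>h. frac_cost I (moves h))"
    using inv cost by (intro measure_pmf.integrable_const_bound[of _ ?W]) (auto simp: AE_measure_pmf_iff)
  have int': "integrable (measure_pmf p) (\<lambda>h. total_price I (bought h))"
    using inv price by (intro measure_pmf.integrable_const_bound[of _ ?W]) (auto simp: AE_measure_pmf_iff)
  have "measure_pmf.expectation p (\<lambda>h. total_price I (bought h) - ?lam * frac_cost I (moves h))
      \<le> potential I (fst ` set (moves ([] :: (('e, 's) frac_move, 's) transcript))) (state_of I [])"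
    unfolding p_def play_def
  proof (rule continue_play_expectation_le[where Inv = "rounding_inv I" and
        F = "\<lambda>h. potential I (fst ` set (moves h)) (state_of I h)" and K = "?W + ?lam * ?W"])
    fix h and m :: "('e, 's) frac_move"
    assume h: "rounding_inv I h" "Some m \<in> set_pmf (D (adversary_view h))"
    let ?x = "mask (revealed I (insert (fst m) (fst ` set (moves h)))) (snd m)"
    interpret rounding_step I "fst ` set (moves h)" "state_of I h" "fst m" ?x
      "insert (fst m) (fst ` set (moves h))" "(arrival I (fst m), ?x)"
      "observe (state_of I h) (arrival I (fst m), ?x)"
      using rounding_step_of_inv[OF h(1) legal[OF h]] .
    show "measure_pmf.expectation (rounding (algorithm_view (frac_obs I) h) (frac_obs I (moves h @ [m])))
        (\<lambda>(r, P). potential I (fst ` set (moves (h @ [(m, r, P)]))) (state_of I (h @ [(m, r, P)])))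
      \<le> potential I (fst ` set (moves h)) (state_of I h)"
      using expected_potential_le
      unfolding rounding_def state_of_snoc frac_obs_snoc moves_snoc fst_set_snoc
      by (simp add: state_of_def)
    show "finite (set_pmf (rounding (algorithm_view (frac_obs I) h) (frac_obs I (moves h @ [m]))))"
      by (simp add: rounding_def respond_eq finite_sample flip: state_of_def add: frac_obs_snoc)
  next
    fix h assume h: "rounding_inv I h"
    show "total_price I (bought h) - ?lam * frac_cost I (moves h)
        \<le> potential I (fst ` set (moves h)) (state_of I h)"
    proof -
      have "?lam * value_of (state_of I h) \<le> ?lam * frac_cost I (moves h)"
        using value_le_frac_cost[OF h] by (intro mult_left_mono) auto
      then show ?thesis
        using potential_ge[of "fst ` set (moves h)" "state_of I h"] h
        by (simp add: rounding_inv_def)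
    qed
    have "\<bar>?lam * frac_cost I (moves h)\<bar> \<le> ?lam * ?W"
      unfolding abs_mult using cost[OF h] by (intro mult_mono) auto
    then show "\<bar>total_price I (bought h) - ?lam * frac_cost I (moves h)\<bar> \<le> ?W + ?lam * ?W"
      using price[OF h] by linarith
  qed (use step rounding_inv_Nil in auto)
  \<comment> \<open>The initial cap 0 removes the logarithm of the initial weight.\<close>
  also have "\<dots> = 0"
    by (simp add: potential_def state_of_def init_state_def total_price_def value_of_def)
  finally show "measure_pmf.expectation p (\<lambda>h. total_price I (bought h))
      \<le> ?lam * measure_pmf.expectation p (\<lambda>h. frac_cost I (moves h))"
    using int int' by simp
qed

end

section \<open>Fractional set cover online\<close>

text \<open>The closed form of the flow in which \<open>c S\<close> times the derivative of
  \<open>x S\<close> is \<open>x S + 1 / card N\<close>: cheap sets grow faster, and the offset lets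
  a set leave the value 0.\<close>

definition grow :: "('s \<Rightarrow> real) \<Rightarrow> 's set \<Rightarrow> ('s \<Rightarrow> real) \<Rightarrow> real \<Rightarrow> 's \<Rightarrow> real" where
  "grow x N c t S =
     (if S \<in> N then (x S + 1 / card N) * exp (t / c S) - 1 / card N else x S)"

text \<open>Free sets are taken fully at once: \<open>t / c S\<close> is 0 for them, so
  \<open>grow\<close> would leave them unchanged.\<close>

definition frac_update :: "('s \<Rightarrow> real) \<Rightarrow> ('e, 's) arrival \<Rightarrow> 's \<Rightarrow> real" where
  "frac_update x a = (case a of (e, N, c) \<Rightarrow>
     if 1 \<le> sum x N then x
     else if \<exists>S\<in>N. c S = 0 then (\<lambda>S. if S \<in> N \<and> c S = 0 then 1 else x S)
     else grow x N c (SOME t. 0 \<le> t \<and> sum (grow x N c t) N = 1))"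

definition frac_run :: "('e, 's) arrival list \<Rightarrow> 's \<Rightarrow> real" where
  "frac_run = foldl frac_update (\<lambda>_. 0)"

lemma grow_exists:
  assumes N: "finite N" "N \<noteq> {}" and x: "\<And>S. 0 \<le> x S" "sum x N \<le> 1"
    and c: "\<And>S. S \<in> N \<Longrightarrow> 0 < c S"
  shows "\<exists>t. 0 \<le> t \<and> sum (grow x N c t) N = 1"
proof -
  obtain S where S: "S \<in> N" using N by auto
  \<comment> \<open>At this time \<open>S\<close> alone has reached 1, even when started from 0, so
    the intermediate value theorem applies up to \<open>t1\<close>.\<close>
  define t1 where "t1 = c S * ln (real (card N) + 1)"
  have d: "0 < real (card N)" using N by (simp add: card_gt_0_iff)
  have t1: "0 \<le> t1" using c[OF S] by (simp add: t1_def)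
  have nonneg: "0 \<le> grow x N c t1 S'" if "S' \<in> N" for S'
  proof -
    have "1 / card N * 1 \<le> (x S' + 1 / card N) * exp (t1 / c S')"
      using x c[OF that] t1 d by (intro mult_mono) auto
    then show ?thesis using that by (simp add: grow_def)
  qed
  have "1 / card N * (real (card N) + 1) \<le> (x S + 1 / card N) * (real (card N) + 1)"
    using x by (intro mult_right_mono) auto
  then have "1 \<le> grow x N c t1 S"
    using S c[OF S] d by (simp add: grow_def t1_def field_simps)
  also have "\<dots> \<le> sum (grow x N c t1) N"
    using N S by (intro member_le_sum nonneg) auto
  finally have "1 \<le> sum (grow x N c t1) N" .
  moreover have "sum (grow x N c 0) N \<le> 1" using x by (simp add: grow_def)
  moreover have "continuous_on {0..t1} (\<lambda>t. sum (grow x N c t) N)"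
    unfolding grow_def by (auto intro!: continuous_intros dest: c)
  ultimately obtain t where "0 \<le> t" "sum (grow x N c t) N = 1"
    using IVT'[of "\<lambda>t. sum (grow x N c t) N" 0 1 t1] t1 by auto
  then show ?thesis by blast
qed

text \<open>
  Here \<open>t\<close> is the amount by which the dual variable of the arriving element is raised, and
  \<open>b\<close> stands for one over the total number of sets, which the algorithm does not know.
\<close>

lemma frac_update_step:
  fixes x c :: "'s \<Rightarrow> real" and N :: "'s set" and e :: 'e
  assumes N: "finite N" "N \<noteq> {}" and x: "\<And>S. 0 \<le> x S" "\<And>S. x S \<le> 1"
    and c: "\<And>S. S \<in> N \<Longrightarrow> 0 \<le> c S"
  defines "x' \<equiv> frac_update x (e, N, c)"
  shows "\<And>S. x S \<le> x' S" "\<And>S. x' S \<le> 1" "\<And>S. S \<notin> N \<Longrightarrow> x' S = x S" "1 \<le> sum x' N"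
    "\<exists>t\<ge>0. (\<Sum>S\<in>N. c S * (x' S - x S)) \<le> 2 * t \<and>
       (\<forall>S\<in>N. (c S = 0 \<longrightarrow> t = 0) \<and>
         (\<forall>b. 0 \<le> b \<longrightarrow> b \<le> 1 / card N \<longrightarrow> (x S + b) * exp (t / c S) \<le> x' S + b))"
proof -
  have d: "0 < real (card N)" using N by (simp add: card_gt_0_iff)
  consider (cov) "1 \<le> sum x N" | (free) "sum x N < 1" "\<exists>S\<in>N. c S = 0"
    | (grow) "sum x N < 1" "\<forall>S\<in>N. 0 < c S"
    using c by (metis linorder_not_le order_less_le)
  then have "(\<forall>S. x S \<le> x' S) \<and> (\<forall>S. x' S \<le> 1) \<and> (\<forall>S. S \<notin> N \<longrightarrow> x' S = x S) \<and> 1 \<le> sum x' N \<and>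
    (\<exists>t\<ge>0. (\<Sum>S\<in>N. c S * (x' S - x S)) \<le> 2 * t \<and>
       (\<forall>S\<in>N. (c S = 0 \<longrightarrow> t = 0) \<and>
         (\<forall>b. 0 \<le> b \<longrightarrow> b \<le> 1 / card N \<longrightarrow> (x S + b) * exp (t / c S) \<le> x' S + b)))"
  proof cases
    case cov
    then have "x' = x" by (simp add: x'_def frac_update_def)
    then show ?thesis using x cov by (auto intro!: exI[of _ 0])
  next
    case free
    then have x': "x' = (\<lambda>S. if S \<in> N \<and> c S = 0 then 1 else x S)"
      by (simp add: x'_def frac_update_def)
    obtain S where S: "S \<in> N" "c S = 0" using free by auto
    have "x' S \<le> sum x' N" using N S x by (intro member_le_sum) (auto simp: x')
    then have "1 \<le> sum x' N" using S by (simp add: x')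
    moreover have "(\<Sum>S\<in>N. c S * (x' S - x S)) = 0" by (intro sum.neutral) (auto simp: x')
    ultimately show ?thesis using x by (auto simp: x' intro!: exI[of _ 0])
  next
    case grow
    define t where "t = (SOME t. 0 \<le> t \<and> sum (grow x N c t) N = 1)"
    have t: "0 \<le> t" "sum (grow x N c t) N = 1"
      using someI_ex[OF grow_exists[of N x c]] N x grow unfolding t_def by auto
    have x': "x' = grow x N c t"
      using grow by (auto simp: x'_def frac_update_def t_def)
    have le: "x S \<le> x' S" for S
    proof (cases "S \<in> N")
      case True
      have "(x S + 1 / card N) * 1 \<le> (x S + 1 / card N) * exp (t / c S)"
        using x grow True t by (intro mult_left_mono) (auto intro!: divide_nonneg_pos)
      then show ?thesis using True by (simp add: x' grow_def)
    qed (simp add: x' grow_def)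
    have nonneg: "0 \<le> x' S" for S using le x order_trans by blast
    have "x' S \<le> 1" for S
    proof (cases "S \<in> N")
      case True
      then have "x' S \<le> sum x' N" using N nonneg by (intro member_le_sum) auto
      then show ?thesis using t by (simp add: x')
    qed (simp add: x' grow_def x)
    moreover have "(\<Sum>S\<in>N. c S * (x' S - x S)) \<le> 2 * t"
    proof -
      \<comment> \<open>The growth rate increases with time, so the final rate bounds the cost of
        the whole increase. Summed over \<open>N\<close>, the final values contribute 1 and the
        offsets another 1, whence the factor 2.\<close>
      have "c S * (x' S - x S) \<le> t * (x' S + 1 / card N)" if S: "S \<in> N" for S
      proof -
        have "x S + 1 / card N = (x' S + 1 / card N) * exp (- (t / c S))"
          using S by (simp add: x' grow_def exp_minus)
        also have "\<dots> \<ge> (x' S + 1 / card N) * (1 - t / c S)"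
          using exp_ge_add_one_self[of "- (t / c S)"] nonneg by (intro mult_left_mono) auto
        finally have "x' S - x S \<le> (x' S + 1 / card N) * (t / c S)"
          by (simp add: algebra_simps)
        then have "c S * (x' S - x S) \<le> c S * ((x' S + 1 / card N) * (t / c S))"
          using grow S by (intro mult_left_mono) (auto intro: less_imp_le)
        moreover have "c S \<noteq> 0" using grow S by auto
        ultimately show ?thesis by (simp add: mult.commute)
      qed
      then have "(\<Sum>S\<in>N. c S * (x' S - x S)) \<le> (\<Sum>S\<in>N. t * (x' S + 1 / card N))"
        by (intro sum_mono)
      also have "\<dots> = 2 * t"
        using t d by (simp add: sum_distrib_left[symmetric] sum.distrib x')
      finally show ?thesis .
    qed
    moreover have "(x S + b) * exp (t / c S) \<le> x' S + b"
      if "S \<in> N" "0 \<le> b" "b \<le> 1 / card N" for S b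
    proof -
      \<comment> \<open>Growth with the offset \<open>1 / card N\<close> dominates growth with any
        smaller offset, so one common \<open>b\<close> can serve all arrivals.\<close>
      have "b * (exp (t / c S) - 1) \<le> 1 / card N * (exp (t / c S) - 1)"
        using that grow t by (intro mult_right_mono) (auto intro!: divide_nonneg_pos)
      then show ?thesis using that by (simp add: x' grow_def algebra_simps)
    qed
    ultimately show ?thesis
      using le t grow by (auto simp: x' grow_def intro!: exI[of _ t])
  qed
  then show "\<And>S. x S \<le> x' S" "\<And>S. x' S \<le> 1" "\<And>S. S \<notin> N \<Longrightarrow> x' S = x S" "1 \<le> sum x' N"
    "\<exists>t\<ge>0. (\<Sum>S\<in>N. c S * (x' S - x S)) \<le> 2 * t \<and>
       (\<forall>S\<in>N. (c S = 0 \<longrightarrow> t = 0) \<and>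
         (\<forall>b. 0 \<le> b \<longrightarrow> b \<le> 1 / card N \<longrightarrow> (x S + b) * exp (t / c S) \<le> x' S + b))"
    by blast+
qed

section \<open>The online fractional solution over a sequence of arrivals\<close>

definition online_frac :: "('e, 's) set_system \<Rightarrow> 'e list \<Rightarrow> 's \<Rightarrow> real" where
  "online_frac I es = frac_run (map (arrival I) es)"

lemma online_frac_Nil [simp]: "online_frac I [] = (\<lambda>_. 0)"
  by (simp add: online_frac_def frac_run_def)

lemma online_frac_snoc: "online_frac I (es @ [e]) = frac_update (online_frac I es) (arrival I e)"
  by (simp add: online_frac_def frac_run_def)

lemma element_legal_snoc:
  "element_legal I (es @ [e]) \<longleftrightarrow> element_legal I es \<and> e \<in> ground I \<and> containing I e \<noteq> {}"
  by (auto simp: element_legal_def)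

text \<open>An update changes only sets containing the arriving element. This later makes the
  masking of observations harmless.\<close>

lemma online_frac_unrevealed: "S \<notin> revealed I (set es) \<Longrightarrow> online_frac I es S = 0"
proof (induction es rule: rev_induct)
  case (snoc e es)
  then have "S \<notin> containing I e" "S \<notin> revealed I (set es)" by (auto simp: revealed_def)
  then show ?case
    using snoc.IH by (auto simp: online_frac_snoc arrival_def frac_update_def grow_def)
qed simp

lemma mask_online_frac: "mask (revealed I (set es)) (online_frac I es) = online_frac I es"
  using online_frac_unrevealed[of _ I es] by (auto simp: mask_def)

context finite_set_system
begin

lemma frac_update_online:
  fixes x :: "'s \<Rightarrow> real" and e :: 'e
  assumes "containing I e \<noteq> {}" "\<And>S. 0 \<le> x S" "\<And>S. x S \<le> 1"
  defines "x' \<equiv> frac_update x (arrival I e)"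
  shows "\<And>S. x S \<le> x' S" "\<And>S. x' S \<le> 1" "1 \<le> sum x' (containing I e)"
    "\<exists>t\<ge>0. (\<Sum>S\<in>family I. price I S * (x' S - x S)) \<le> 2 * t \<and>
       (\<forall>S\<in>containing I e. (price I S = 0 \<longrightarrow> t = 0) \<and>
         (\<forall>b. 0 \<le> b \<longrightarrow> b \<le> 1 / card (containing I e) \<longrightarrow>
            (x S + b) * exp (t / price I S) \<le> x' S + b))"
proof -
  let ?c = "mask (containing I e) (price I)"
  have c: "0 \<le> ?c S" if "S \<in> containing I e" for S
    using that subsetD[OF containing_subset that] by (simp add: mask_def price_nonneg)
  note step = frac_update_step[OF finite_containing[of e] assms(1,2,3) c, where e = e]
  have x': "x' = frac_update x (e, containing I e, ?c)" by (simp add: x'_def arrival_def)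
  show "x S \<le> x' S" "x' S \<le> 1" "1 \<le> sum x' (containing I e)" for S
    unfolding x' using step(1,2,4) by auto
  have "(\<Sum>S\<in>family I. price I S * (x' S - x S)) = (\<Sum>S\<in>containing I e. ?c S * (x' S - x S))"
    using step(3) by (intro sum.mono_neutral_cong_right finite_family containing_subset)
      (auto simp: x' mask_def)
  then show "\<exists>t\<ge>0. (\<Sum>S\<in>family I. price I S * (x' S - x S)) \<le> 2 * t \<and>
       (\<forall>S\<in>containing I e. (price I S = 0 \<longrightarrow> t = 0) \<and>
         (\<forall>b. 0 \<le> b \<longrightarrow> b \<le> 1 / card (containing I e) \<longrightarrow>
            (x S + b) * exp (t / price I S) \<le> x' S + b))"
    using step(5) by (simp add: x' mask_def)
qed

lemma online_frac_bounds:
  "element_legal I es \<Longrightarrow> 0 \<le> online_frac I es S \<and> online_frac I es S \<le> 1"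
proof (induction es arbitrary: S rule: rev_induct)
  case (snoc e es)
  then have b: "0 \<le> online_frac I es S" "online_frac I es S \<le> 1" for S
    by (auto simp: element_legal_snoc)
  have "containing I e \<noteq> {}" using snoc.prems by (simp add: element_legal_snoc)
  then have "online_frac I es S \<le> online_frac I (es @ [e]) S" "online_frac I (es @ [e]) S \<le> 1"
    unfolding online_frac_snoc by (intro frac_update_online b; assumption)+
  with b(1)[of S] show ?case by simp
qed simp

lemma online_frac_mono:
  assumes "element_legal I (es @ [e])"
  shows "online_frac I es S \<le> online_frac I (es @ [e]) S"
  unfolding online_frac_snoc using assms online_frac_bounds[of es]
  by (intro frac_update_online) (auto simp: element_legal_snoc)

lemma online_frac_feasible:
  "element_legal I es \<Longrightarrow> frac_feasible I (online_frac I es) (set es)"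
proof (induction es rule: rev_induct)
  case Nil
  then show ?case by (simp add: frac_feasible_def)
next
  case (snoc e es)
  have "1 \<le> sum (online_frac I (es @ [e])) (containing I e)"
    unfolding online_frac_snoc using snoc.prems online_frac_bounds[of es]
    by (intro frac_update_online) (auto simp: element_legal_snoc)
  moreover have "1 \<le> sum (online_frac I (es @ [e])) (containing I e')" if "e' \<in> set es" for e'
  proof -
    have "1 \<le> sum (online_frac I es) (containing I e')"
      using that snoc by (simp add: element_legal_snoc frac_feasible_def)
    also have "\<dots> \<le> sum (online_frac I (es @ [e])) (containing I e')"
      by (intro sum_mono online_frac_mono snoc.prems)
    finally show ?thesis .
  qed
  ultimately show ?case by (auto simp: frac_feasible_def)
qed

text \<open>
  The function \<open>y\<close> is a solution of the dual packing linear program that becomes feasible after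
  division by \<open>ln (card (family I) + 1)\<close>.
\<close>

lemma online_frac_dual:
  assumes "element_legal I es"
  shows "\<exists>y. (\<forall>e. 0 \<le> y e) \<and>
    (\<Sum>S\<in>family I. price I S * online_frac I es S) \<le> 2 * sum y (set es) \<and>
    (\<forall>S\<in>family I. (price I S = 0 \<longrightarrow> sum y (set es \<inter> members I S) = 0) \<and>
      1 / card (family I) * exp (sum y (set es \<inter> members I S) / price I S)
        \<le> online_frac I es S + 1 / card (family I))"
  using assms
proof (induction es rule: rev_induct)
  case Nil
  then show ?case by (auto intro!: exI[of _ "\<lambda>_. 0"])
next
  case (snoc e es)
  let ?x = "online_frac I es" and ?x' = "online_frac I (es @ [e])"
  let ?b = "1 / real (card (family I))"
  obtain y where y: "\<And>e. 0 \<le> y e" "(\<Sum>S\<in>family I. price I S * ?x S) \<le> 2 * sum y (set es)"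
    "\<And>S. S \<in> family I \<Longrightarrow> price I S = 0 \<Longrightarrow> sum y (set es \<inter> members I S) = 0"
    "\<And>S. S \<in> family I \<Longrightarrow> ?b * exp (sum y (set es \<inter> members I S) / price I S) \<le> ?x S + ?b"
    using snoc by (auto simp: element_legal_snoc)
  have ne: "containing I e \<noteq> {}" using snoc.prems by (simp add: element_legal_snoc)
  have bnd: "0 \<le> ?x S" "?x S \<le> 1" for S
    using snoc.prems online_frac_bounds[of es] by (auto simp: element_legal_snoc)
  obtain t where t: "0 \<le> t" "(\<Sum>S\<in>family I. price I S * (?x' S - ?x S)) \<le> 2 * t"
    and t': "\<forall>S\<in>containing I e. (price I S = 0 \<longrightarrow> t = 0) \<and>
      (\<forall>b. 0 \<le> b \<longrightarrow> b \<le> 1 / card (containing I e) \<longrightarrow>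
        (?x S + b) * exp (t / price I S) \<le> ?x' S + b)"
    using frac_update_online(4)[where x = ?x and e = e, OF ne bnd, folded online_frac_snoc]
    by (elim exE conjE) (rule that)
  have card: "0 < card (containing I e)" "card (containing I e) \<le> card (family I)"
    using ne card_mono[OF finite_family containing_subset] by (simp_all add: card_gt_0_iff)
  \<comment> \<open>No element lies in more than \<open>card (family I)\<close> sets, so this offset
    is admissible at every arrival.\<close>
  then have b: "?b \<le> 1 / card (containing I e)" by (intro divide_left_mono) auto
  \<comment> \<open>The values of \<open>y\<close> outside \<open>set es\<close> are arbitrary and
    get reset to 0; adding \<open>t\<close> at \<open>e\<close> is then right both for a new element
    and for one that arrives again.\<close>
  define y0 where "y0 e' = (if e' \<in> set es then y e' else 0)" for e'
  define y' where "y' = y0(e := y0 e + t)"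
  have y': "y' e' = y0 e' + (if e' = e then t else 0)" for e' by (simp add: y'_def)
  have sum_y': "sum y' (insert e (set es) \<inter> B) = sum y (set es \<inter> B) + (if e \<in> B then t else 0)" for B
  proof -
    have "sum y' (insert e (set es) \<inter> B) = sum y0 (insert e (set es) \<inter> B) + (if e \<in> B then t else 0)"
      unfolding y' sum.distrib by simp
    also have "sum y0 (insert e (set es) \<inter> B) = sum y (set es \<inter> B)"
      by (rule sum.mono_neutral_cong_right) (auto simp: y0_def)
    finally show ?thesis .
  qed
  have "(\<Sum>S\<in>family I. price I S * ?x' S)
      = (\<Sum>S\<in>family I. price I S * ?x S) + (\<Sum>S\<in>family I. price I S * (?x' S - ?x S))"
    by (simp add: sum.distrib[symmetric] algebra_simps)
  also have "\<dots> \<le> 2 * sum y' (set (es @ [e]))"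
    using y(2) t(2) sum_y'[of UNIV] by simp
  finally have cost: "(\<Sum>S\<in>family I. price I S * ?x' S) \<le> 2 * sum y' (set (es @ [e]))" .
  have "(price I S = 0 \<longrightarrow> sum y' (set (es @ [e]) \<inter> members I S) = 0) \<and>
      ?b * exp (sum y' (set (es @ [e]) \<inter> members I S) / price I S) \<le> ?x' S + ?b"
    if S: "S \<in> family I" for S
  proof (cases "e \<in> members I S")
    case True
    then have Se: "S \<in> containing I e" using S by (simp add: containing_def)
    have "?b * exp ((sum y (set es \<inter> members I S) + t) / price I S)
        = ?b * exp (sum y (set es \<inter> members I S) / price I S) * exp (t / price I S)"
      by (simp add: add_divide_distrib exp_add)
    also have "\<dots> \<le> (?x S + ?b) * exp (t / price I S)"
      using y(4)[OF S] by (intro mult_right_mono) auto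
    also have "\<dots> \<le> ?x' S + ?b"
      using t'[rule_format, OF Se] b by simp
    finally show ?thesis using y(3)[OF S] t'[rule_format, OF Se] True sum_y'[of "members I S"] by simp
  next
    case False
    then show ?thesis
      using y(3,4)[OF S] sum_y'[of "members I S"] online_frac_mono[OF snoc.prems, of S]
      by simp
  qed
  moreover have "0 \<le> y' e'" for e' using y(1) t(1) by (simp add: y' y0_def)
  ultimately show ?case using cost by blast
qed

section \<open>Comparison with the offline optimum\<close>

lemma opt_attained:
  assumes "element_legal I es"
  obtains \<C> where "covers I \<C> (set es)" "opt I (set es) = total_price I \<C>"
proof -
  let ?K = "{\<C>. covers I \<C> (set es)}"
  have "finite ?K"
    by (rule finite_subset[of _ "Pow (family I)"]) (auto simp: covers_def finite_family)
  \<comment> \<open>Legal elements lie in some set, so the whole family is a cover and the minimum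
    ranges over a nonempty collection.\<close>
  moreover have "family I \<in> ?K"
    using assms by (fastforce simp: covers_def element_legal_def containing_def)
  ultimately have "opt I (set es) \<in> total_price I ` ?K"
    unfolding opt_def by (intro Min_in) auto
  then show ?thesis using that by auto
qed

lemma opt_bounds:
  assumes "element_legal I es"
  shows "0 \<le> opt I (set es)" "opt I (set es) \<le> total_price I (family I)"
proof -
  obtain \<C> where "covers I \<C> (set es)" "opt I (set es) = total_price I \<C>"
    using opt_attained[OF assms] .
  then show "0 \<le> opt I (set es)" "opt I (set es) \<le> total_price I (family I)"
    by (auto simp: covers_def intro: total_price_nonneg total_price_mono)
qed

text \<open>Weak duality: since no fractional value exceeds 1, the exponential bound caps the dual
  load of each set by \<open>?ln\<close> times its price, and the loads of the sets of an optimal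
  cover together dominate the dual value.\<close>

lemma online_frac_cost:
  assumes "element_legal I es"
  shows "(\<Sum>S\<in>family I. price I S * online_frac I es S)
    \<le> 2 * ln (real (card (family I)) + 1) * opt I (set es)"
proof -
  let ?m = "real (card (family I))"
  let ?ln = "ln (?m + 1)"
  obtain \<C> where cov: "covers I \<C> (set es)" and opt: "opt I (set es) = total_price I \<C>"
    by (rule opt_attained[OF assms])
  then have \<C>: "\<C> \<subseteq> family I" "set es \<subseteq> (\<Union>S\<in>\<C>. members I S)"
    by (simp_all add: covers_def)
  have fin: "finite \<C>" using finite_subset[OF \<C>(1) finite_family] .
  obtain y where y: "\<forall>e. 0 \<le> y e"
    "(\<Sum>S\<in>family I. price I S * online_frac I es S) \<le> 2 * sum y (set es)"
    and y': "\<forall>S\<in>family I. (price I S = 0 \<longrightarrow> sum y (set es \<inter> members I S) = 0) \<and>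
      1 / ?m * exp (sum y (set es \<inter> members I S) / price I S) \<le> online_frac I es S + 1 / ?m"
    using online_frac_dual[OF assms] by (elim exE conjE) (rule that)
  have dual: "sum y (set es \<inter> members I S) \<le> ?ln * price I S" if S: "S \<in> family I" for S
  proof (cases "price I S = 0")
    \<comment> \<open>For a free set the exponential bound is void, as division by 0 yields 0; its
      load is 0 by the other conjunct.\<close>
    case True
    then show ?thesis using y' S by simp
  next
    case False
    then have pos: "0 < price I S" using price_nonneg[OF S] by simp
    have m: "0 < ?m" using S finite_family by (auto simp: card_gt_0_iff)
    have "1 / ?m * exp (sum y (set es \<inter> members I S) / price I S) \<le> 1 + 1 / ?m"
      using bspec[OF y' S] online_frac_bounds[OF assms, of S] by linarith
    then have "exp (sum y (set es \<inter> members I S) / price I S) \<le> ?m + 1"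
      using m by (simp add: field_simps)
    then have "sum y (set es \<inter> members I S) / price I S \<le> ?ln"
      using m by (simp add: ln_ge_iff)
    then show ?thesis using pos by (simp add: field_simps)
  qed
  have "sum y (set es) \<le> sum y (\<Union>S\<in>\<C>. set es \<inter> members I S)"
    using \<C> y(1) fin by (intro sum_mono2) auto
  also have "\<dots> \<le> (\<Sum>S\<in>\<C>. sum y (set es \<inter> members I S))"
    using fin
  proof (induction \<C> rule: finite_induct)
    case (insert S \<C>)
    have "sum y (A \<union> B) \<le> sum y A + sum y B" if "finite A" "finite B" for A B
      using sum.union_inter[OF that, of y] sum_nonneg[of "A \<inter> B" y] y(1) by simp
    from this[of "set es \<inter> members I S" "\<Union>S\<in>\<C>. set es \<inter> members I S"] insert show ?case
      by simp
  qed simp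
  also have "\<dots> \<le> (\<Sum>S\<in>\<C>. ?ln * price I S)"
    using \<C> by (intro sum_mono dual) auto
  also have "\<dots> = ?ln * opt I (set es)" by (simp add: opt total_price_def sum_distrib_left)
  finally show ?thesis using y(2) by simp
qed

end

section \<open>Rounding the online fractional solution\<close>

text \<open>It takes the whole list of arrivals so as to serve as an observation function:
  \<open>algorithm_view (with_frac I)\<close> turns a transcript of the element game into one of the
  fractional game.\<close>

definition with_frac :: "('e, 's) set_system \<Rightarrow> 'e list \<Rightarrow> ('e, 's) frac_move" where
  "with_frac I es = (last es, online_frac I es)"

definition frac_moves :: "('e, 's) set_system \<Rightarrow> 'e list \<Rightarrow> ('e, 's) frac_move list" where
  "frac_moves I es = map (\<lambda>j. with_frac I (take (Suc j) es)) [0..<length es]"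

definition observe_frac :: "('e, 's) arrival list \<Rightarrow> ('e, 's) frac_arrival" where
  "observe_frac ars = (last ars, frac_run ars)"

text \<open>The algorithm reads its own past as a transcript whose moves are arrivals; viewing it
  through \<open>observe_frac\<close> supplies the fractional solutions and yields the past that
  \<open>rounding\<close> expects.\<close>

definition set_cover_alg :: "(('e, 's) arrival, 's) algorithm" where
  "set_cover_alg past a =
     rounding (algorithm_view observe_frac past) (observe_frac (moves past @ [a]))"

text \<open>
  Stopping on histories that cannot arise makes this adversary legal after every legal history,
  as \<open>obeys\<close> demands.
\<close>

definition frac_adversary ::
  "('e, 's) set_system \<Rightarrow> ('e, 's) adversary \<Rightarrow> (('e, 's) frac_move, 's) adversary" where
  "frac_adversary I D v = (let es = map (fst \<circ> fst) v in
     if map fst v = frac_moves I es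
     then map_pmf (map_option (\<lambda>e. with_frac I (es @ [e]))) (D (map (\<lambda>(m, P). (fst m, P)) v))
     else return_pmf None)"

lemma frac_moves_snoc: "frac_moves I (es @ [e]) = frac_moves I es @ [with_frac I (es @ [e])]"
  by (simp add: frac_moves_def)

lemma frac_moves_Nil [simp]: "frac_moves I [] = []"
  by (simp add: frac_moves_def)

lemma map_fst_frac_moves [simp]: "map fst (frac_moves I es) = es"
  by (induction es rule: rev_induct) (simp_all add: frac_moves_snoc with_frac_def)

lemma frac_moves_eq_Nil [simp]: "frac_moves I es = [] \<longleftrightarrow> es = []"
  by (simp add: frac_moves_def)

lemma last_frac_moves: "es \<noteq> [] \<Longrightarrow> last (frac_moves I es) = with_frac I es"
  by (cases es rule: rev_exhaust) (simp_all add: frac_moves_snoc)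

lemma fst_set_frac_moves [simp]: "fst ` set (frac_moves I es) = set es"
  by (metis map_fst_frac_moves set_map)

lemma moves_algorithm_view: "moves (algorithm_view f h) = map (\<lambda>j. f (take (Suc j) (moves h))) [0..<length h]"
  by (simp add: moves_def algorithm_view_def)

lemma moves_with_frac: "moves (algorithm_view (with_frac I) h) = frac_moves I (moves h)"
  by (simp add: moves_algorithm_view frac_moves_def)

lemma moves_element_obs: "moves (algorithm_view (element_obs I) h) = map (arrival I) (moves h)"
  by (induction h rule: rev_induct) (auto simp: element_obs_def)

lemma purchases_algorithm_view [simp]: "purchases (algorithm_view f h) = purchases h"
  by (induction h rule: rev_induct) auto

lemma bought_algorithm_view [simp]: "bought (algorithm_view f h) = bought h"
  by (simp add: bought_def)

text \<open>Masking hides nothing of the online solution, so what the fractional game shows can be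
  computed from the arrivals alone.\<close>

lemma frac_obs_with_frac:
  "frac_obs I (frac_moves I (es @ [e])) = observe_frac (map (arrival I) (es @ [e]))"
  using mask_online_frac[of I "es @ [e]"]
  by (simp add: frac_obs_def frac_moves_snoc observe_frac_def with_frac_def online_frac_def)

lemma algorithm_view_with_frac:
  "algorithm_view (frac_obs I) (algorithm_view (with_frac I) h)
    = algorithm_view observe_frac (algorithm_view (element_obs I) h)"
proof (induction h rule: rev_induct)
  case (snoc a h)
  obtain e r P where a: "a = (e, r, P)" by (cases a)
  have "moves (algorithm_view (with_frac I) h) @ [with_frac I (moves h @ [e])]
      = frac_moves I (moves h @ [e])"
    by (simp add: moves_with_frac frac_moves_snoc)
  moreover have "moves (algorithm_view (element_obs I) h) @ [element_obs I (moves h @ [e])]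
      = map (arrival I) (moves h @ [e])"
    by (simp add: moves_element_obs element_obs_def)
  ultimately show ?case using snoc frac_obs_with_frac[of I "moves h" e] by (simp add: a)
qed simp

text \<open>The fractional values are a function of the elements, so dropping them recovers what
  \<open>D\<close> sees, and the guard of \<open>frac_adversary\<close> holds on translated
  transcripts.\<close>

lemma frac_adversary_view:
  "frac_adversary I D (adversary_view (algorithm_view (with_frac I) h))
    = map_pmf (map_option (\<lambda>e. with_frac I (moves h @ [e]))) (D (adversary_view h))"
proof -
  have "map (\<lambda>(m, P). (fst m, P)) (adversary_view (algorithm_view (with_frac I) h)) = adversary_view h"
    by (induction h rule: rev_induct) (auto simp: adversary_view_def with_frac_def)
  moreover have "map (fst \<circ> fst) (adversary_view (algorithm_view (with_frac I) h)) = moves h"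
    by (simp add: moves_with_frac flip: map_map)
  ultimately show ?thesis
    by (simp add: frac_adversary_def Let_def moves_with_frac)
qed

text \<open>A coupling: both games make the same random choices, so the cost bound for rounding
  carries over to \<open>set_cover_alg\<close>.\<close>

lemma continue_play_with_frac:
  "continue_play (frac_obs I) rounding (frac_adversary I D) t (algorithm_view (with_frac I) h)
    = map_pmf (algorithm_view (with_frac I)) (continue_play (element_obs I) set_cover_alg D t h)"
proof (induction t arbitrary: h)
  case (Suc t)
  have alg: "rounding (algorithm_view (frac_obs I) (algorithm_view (with_frac I) h))
        (frac_obs I (moves (algorithm_view (with_frac I) h) @ [with_frac I (moves h @ [e])]))
      = set_cover_alg (algorithm_view (element_obs I) h) (element_obs I (moves h @ [e]))" for e
    using frac_obs_with_frac[of I "moves h" e]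
    by (simp add: set_cover_alg_def algorithm_view_with_frac moves_with_frac moves_element_obs
        frac_moves_snoc element_obs_def)
  have snoc: "algorithm_view (with_frac I) h @ [(with_frac I (moves h @ [e]), rP)]
      = algorithm_view (with_frac I) (h @ [(e, rP)])" for e rP
    by (cases rP) simp
  show ?case
    unfolding continue_play.simps frac_adversary_view bind_map_pmf map_bind_pmf
    by (intro bind_pmf_cong refl)
      (auto simp: alg snoc Suc.IH map_bind_pmf case_prod_unfold simp del: algorithm_view_snoc
        split: option.split)
qed simp

lemma play_with_frac:
  "play (frac_obs I) rounding (frac_adversary I D) T
    = map_pmf (algorithm_view (with_frac I)) (play (element_obs I) set_cover_alg D T)"
  using continue_play_with_frac[of I D T "[]"] by (simp add: play_def)

section \<open>Legality of the induced adversary and cost of the combined algorithm\<close>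

context finite_set_system
begin

text \<open>Feasibility excludes elements that lie in no set, since an empty sum is 0.\<close>

lemma element_legal_of_frac_legal:
  assumes "frac_legal I ms"
  shows "element_legal I (map fst ms)"
  using assms
proof (induction ms rule: rev_induct)
  case (snoc m ms)
  then show ?case by (auto simp: frac_legal_snoc element_legal_snoc frac_feasible_def)
qed (simp add: element_legal_def)

lemma frac_legal_frac_moves: "element_legal I es \<Longrightarrow> frac_legal I (frac_moves I es)"
proof (induction es rule: rev_induct)
  case (snoc e es)
  then show ?case
    using online_frac_bounds[OF snoc.prems] online_frac_feasible[OF snoc.prems]
      online_frac_mono[OF snoc.prems]
    by (simp add: frac_moves_snoc frac_legal_snoc element_legal_snoc last_frac_moves)
      (simp add: with_frac_def)
qed simp

lemma obeys_frac_adversary: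
  assumes "obeys D (element_legal I)"
  shows "obeys (frac_adversary I D) (frac_legal I)"
  unfolding obeys_def
proof (intro allI impI)
  fix v m
  assume legal: "frac_legal I (map fst v)" and m: "Some m \<in> set_pmf (frac_adversary I D v)"
  define es where "es = map (fst \<circ> fst) v"
  define w where "w = map (\<lambda>(m, P). (fst m, P)) v"
  \<comment> \<open>A further move is possible only if the guard of \<open>frac_adversary\<close>
    held, for otherwise the game stops.\<close>
  have es: "map fst v = frac_moves I es"
    using m by (auto simp: frac_adversary_def Let_def es_def split: if_splits)
  then obtain e where e: "Some e \<in> set_pmf (D w)" "m = with_frac I (es @ [e])"
    using m by (auto simp: frac_adversary_def Let_def es_def[symmetric] w_def[symmetric])
  have w: "map fst w = es" by (auto simp: w_def es_def)
  have "element_legal I es"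
    using element_legal_of_frac_legal[OF legal] by (simp add: es)
  then have "element_legal I (es @ [e])"
    using assms e(1) unfolding obeys_def w[symmetric] by blast
  then show "frac_legal I (map fst v @ [m])"
    using frac_legal_frac_moves[of "es @ [e]"] by (simp add: es e(2) frac_moves_snoc)
qed

lemma set_cover_cost:
  fixes D :: "('e, 's) adversary" and T :: nat
  assumes obeys: "obeys D (element_legal I)"
  defines "p \<equiv> play (element_obs I) set_cover_alg D T"
  shows "\<And>h. h \<in> set_pmf p \<Longrightarrow> covers_online I (moves h) (purchases h)"
    and "\<And>h. h \<in> set_pmf p \<Longrightarrow> element_legal I (moves h)"
    and "measure_pmf.expectation p (\<lambda>h. total_price I (bought h))
      \<le> 24 * (ln (real (card (ground I)) + 1) * ln (real (card (family I)) + 1)) *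
        measure_pmf.expectation p (\<lambda>h. opt I (set (moves h)))"
proof -
  let ?lam = "12 * ln (real (card (ground I)) + 1)"
  let ?mu = "2 * ln (real (card (family I)) + 1)"
  note rounding = rounding_cost[OF obeys_frac_adversary[OF obeys], where T = T,
      unfolded play_with_frac, folded p_def]
  have inv: "rounding_inv I (algorithm_view (with_frac I) h)" if "h \<in> set_pmf p" for h
    using rounding(1) that by simp
  show "covers_online I (moves h) (purchases h)" if "h \<in> set_pmf p" for h
    using inv[OF that] by (simp add: rounding_inv_def moves_with_frac)
  show legal: "element_legal I (moves h)" if "h \<in> set_pmf p" for h
    using inv[OF that] element_legal_of_frac_legal[of "frac_moves I (moves h)"]
    by (simp add: rounding_inv_def moves_with_frac)
  \<comment> \<open>Given the arrivals, the fractional solution is deterministic, so the comparison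
    with the optimum holds on each outcome and survives taking expectations.\<close>
  have cost: "frac_cost I (frac_moves I es) \<le> ?mu * opt I (set es)" if "element_legal I es" for es
    using online_frac_cost[OF that] opt_bounds(1)[OF that]
    by (auto simp: frac_cost_def last_frac_moves with_frac_def)
  have int: "integrable (measure_pmf p) (\<lambda>h. opt I (set (moves h)))"
    using legal opt_bounds
    by (intro measure_pmf.integrable_const_bound[of _ "total_price I (family I)"])
      (auto simp: AE_measure_pmf_iff)
  have "measure_pmf.expectation p (\<lambda>h. total_price I (bought h))
      \<le> ?lam * measure_pmf.expectation p (\<lambda>h. frac_cost I (frac_moves I (moves h)))"
    using rounding(3) by (simp add: moves_with_frac)
  also have "\<dots> \<le> ?lam * measure_pmf.expectation p (\<lambda>h. ?mu * opt I (set (moves h)))"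
    using rounding(2) int legal cost
    by (intro mult_left_mono integral_mono_AE)
      (auto simp: AE_measure_pmf_iff moves_with_frac integrable_map_pmf_eq)
  finally show "measure_pmf.expectation p (\<lambda>h. total_price I (bought h))
      \<le> 24 * (ln (real (card (ground I)) + 1) * ln (real (card (family I)) + 1)) *
        measure_pmf.expectation p (\<lambda>h. opt I (set (moves h)))"
    by (simp add: mult_ac)
qed

end

text \<open>For such \<open>n\<close>, \<open>n + 1 \<le> 2 * n \<le> n ^ 2\<close>. This trades the
  logarithms of successors, which the potential and the dual produce, for those in the
  theorem.\<close>

lemma ln_add_one_le: "2 \<le> n \<Longrightarrow> ln (real n + 1) \<le> 2 * ln (real n)"
proof -
  assume n: "2 \<le> n"
  then have "2 * real n \<le> real n ^ 2" by (simp add: power2_eq_square)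
  then have "real n + 1 \<le> real n ^ 2" using n by simp
  then have "ln (real n + 1) \<le> ln (real n ^ 2)" using n by (subst ln_le_cancel_iff) auto
  then show ?thesis using n by (simp add: ln_realpow)
qed

theorem theorem6:
  shows
    "(\<exists>(C :: real) (A :: (('e, 's) frac_arrival, 's) algorithm).
        \<forall>(I :: ('e, 's) set_system) (D :: (('e, 's) frac_move, 's) adversary) (T :: nat).
          super_instance I \<longrightarrow> 2 \<le> card (ground I) \<longrightarrow> obeys D (frac_legal I) \<longrightarrow>
            (\<forall>h \<in> set_pmf (play (frac_obs I) A D T).
               covers_online I (map fst (moves h)) (purchases h)) \<and>
            measure_pmf.expectation (play (frac_obs I) A D T) (\<lambda>h. total_price I (bought h))
              \<le> C * ln (real (card (ground I))) *
                measure_pmf.expectation (play (frac_obs I) A D T) (\<lambda>h. frac_cost I (moves h)))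
     \<and>
     (\<exists>(C :: real) (B :: (('e, 's) arrival, 's) algorithm).
        \<forall>(I :: ('e, 's) set_system) (D :: ('e, 's) adversary) (T :: nat).
          super_instance I \<longrightarrow> 2 \<le> card (ground I) \<longrightarrow> 2 \<le> card (family I) \<longrightarrow>
          obeys D (element_legal I) \<longrightarrow>
            (\<forall>h \<in> set_pmf (play (element_obs I) B D T).
               covers_online I (moves h) (purchases h)) \<and>
            measure_pmf.expectation (play (element_obs I) B D T) (\<lambda>h. total_price I (bought h))
              \<le> C * (ln (real (card (ground I))) * ln (real (card (family I)))) *
                measure_pmf.expectation (play (element_obs I) B D T) (\<lambda>h. opt I (set (moves h))))"
\<comment> \<open>The constants are 2 times 12 and 4 times 24: each use of
  \<open>ln_add_one_le\<close> costs a factor 2.\<close>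
proof (rule conjI[OF exI[of _ 24] exI[of _ 96]];
    (rule exI[of _ rounding] | rule exI[of _ set_cover_alg]); intro conjI allI impI ballI)
  fix I :: "('e, 's) set_system" and D :: "(('e, 's) frac_move, 's) adversary" and T :: nat
  assume I: "super_instance I" "2 \<le> card (ground I)" and D: "obeys D (frac_legal I)"
  interpret finite_set_system I by standard (rule I)
  note cost = rounding_cost[OF D, where T = T]
  let ?p = "play (frac_obs I) rounding D T"
  show "covers_online I (map fst (moves h)) (purchases h)" if "h \<in> set_pmf ?p" for h
    using cost(1)[OF that] by (simp add: rounding_inv_def)
  note cost(3)
  also have "12 * ln (real (card (ground I)) + 1) * measure_pmf.expectation ?p (\<lambda>h. frac_cost I (moves h))
      \<le> 24 * ln (real (card (ground I))) * measure_pmf.expectation ?p (\<lambda>h. frac_cost I (moves h))"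
    using ln_add_one_le[OF I(2)] cost(1) frac_cost_bounds(1)
    by (intro mult_right_mono integral_nonneg_AE) (auto simp: AE_measure_pmf_iff rounding_inv_def)
  finally show "measure_pmf.expectation ?p (\<lambda>h. total_price I (bought h))
      \<le> 24 * ln (real (card (ground I))) * measure_pmf.expectation ?p (\<lambda>h. frac_cost I (moves h))" .
next
  fix I :: "('e, 's) set_system" and D :: "('e, 's) adversary" and T :: nat
  assume I: "super_instance I" "2 \<le> card (ground I)" "2 \<le> card (family I)"
    and D: "obeys D (element_legal I)"
  interpret finite_set_system I by standard (rule I)
  note cost = set_cover_cost[OF D, where T = T]
  let ?p = "play (element_obs I) set_cover_alg D T"
  let ?n = "real (card (ground I))" and ?m = "real (card (family I))"
  show "covers_online I (moves h) (purchases h)" if "h \<in> set_pmf ?p" for h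
    using cost(1)[OF that] .
  have "ln (?n + 1) * ln (?m + 1) \<le> (2 * ln ?n) * (2 * ln ?m)"
    using I by (intro mult_mono ln_add_one_le) auto
  moreover have "0 \<le> measure_pmf.expectation ?p (\<lambda>h. opt I (set (moves h)))"
    using cost(2) opt_bounds(1)
    by (intro integral_nonneg_AE) (auto simp: AE_measure_pmf_iff)
  ultimately have "24 * (ln (?n + 1) * ln (?m + 1)) * measure_pmf.expectation ?p (\<lambda>h. opt I (set (moves h)))
      \<le> 96 * (ln ?n * ln ?m) * measure_pmf.expectation ?p (\<lambda>h. opt I (set (moves h)))"
    by (intro mult_right_mono) auto
  with cost(3) show "measure_pmf.expectation ?p (\<lambda>h. total_price I (bought h))
      \<le> 96 * (ln ?n * ln ?m) * measure_pmf.expectation ?p (\<lambda>h. opt I (set (moves h)))"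
    by linarith
qed

end
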